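(* Let $\mathcal{K}\subset\mathbb{R}^N$ be a convex body. Then $$\mathrm{diam}[\heartsuit(\mathcal{K})]\ge\max\left(|M_{\mathcal{K}}-C_{\mathcal{K}}|,\ |C_{\mathcal{K}}-I_{\mathcal{M}}|,\ |I_{\mathcal{M}}-M_{\mathcal{K}}|\right).$$
   Context: A convex body in $\mathbb{R}^N$ is a compact convex set with non-empty interior. $M_{\mathcal{K}}=\frac{1}{|\mathcal{K}|}\int_{\mathcal{K}}y\,dy$ is the center of mass of $\mathcal{K}$. The circumcenter $C_{\mathcal{K}}$ is the center of the smallest ball containing $\mathcal{K}$. The inradius $r_{\mathcal{K}}$ is the radius of the largest balls contained in $\mathcal{K}$, and $\mathcal{M}(\mathcal{K})=\{x\in\mathcal{K}:\mathrm{dist}(x,\partial\mathcal{K})=r_{\mathcal{K}}\}$ is the (convex) set of incenters. $I_{\mathcal{M}}$ is the center of mass of $\mathcal{M}(\mathcal{K})$: if $\mathcal{M}(\mathcal{K})$ has dimension $k\ge1$ (dimension of its affine hull), $I_{\mathcal{M}}=\frac{1}{\mathcal{H}^k(\mathcal{M}(\mathcal{K}))}\int_{\mathcal{M}(\mathcal{K})}y\,d\mathcal{H}^k(y)$ with $\mathcal{H}^k$ the $k$-dimensional Hausdorff measure; if $\mathcal{M}(\mathcal{K})$ is a single point, $I_{\mathcal{M}}$ is that point. For $\omega\in\mathbb{S}^{N-1}$ (the unit sphere) and $\lambda\in\mathbb{R}$, $T_{\lambda,\omega}$ is the reflection of $\mathbb{R}^N$ in the hyperplane $\{x:\langle x,\omega\rangle=\lambda\}$,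 and $\mathcal{K}_{\lambda,\omega}=\{x\in\mathcal{K}:\langle x,\omega\rangle\ge\lambda\}$. The maximal folding function is $\mathcal{R}_{\mathcal{K}}(\omega)=\min\{\lambda\in\mathbb{R}: T_{\lambda,\omega}(\mathcal{K}_{\lambda,\omega})\subseteq\mathcal{K}\}$. The heart of $\mathcal{K}$ is $\heartsuit(\mathcal{K})=\{x\in\mathcal{K}:\langle x,\omega\rangle\le\mathcal{R}_{\mathcal{K}}(\omega)\text{ for every }\omega\in\mathbb{S}^{N-1}\}$. *)

theory Defs
  imports "HOL-Analysis.Analysis"
begin

definition convex_body :: "'a::euclidean_space set \<Rightarrow> bool" where
  "convex_body K \<longleftrightarrow> compact K \<and> convex K \<and> interior K \<noteq> {}"

text \<open>
  Hausdorff measure, with the usual normalisation that makes the measure of dimension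
  \<open>DIM('a)\<close> agree with Lebesgue measure.  The covering sets are required to be bounded
  because the library's \<^const>\<open>diameter\<close> is unspecified on unbounded sets.  Empty covering
  sets contribute \<open>0\<close> only for \<open>k \<ge> 1\<close> under the formula (since \<open>0 ^ 0 = 1\<close>), hence the
  case distinction.  Since this is a metric outer measure, its restriction to the Borel sets is
  countably additive, so \<^const>\<open>measure_of\<close> does not collapse to the zero measure.
\<close>

definition hausdorff_content :: "nat \<Rightarrow> real \<Rightarrow> 'a::metric_space set \<Rightarrow> ennreal" where
  "hausdorff_content k \<delta> A =
     (INF U \<in> {U :: nat \<Rightarrow> 'a set. A \<subseteq> (\<Union>i. U i) \<and> (\<forall>i. bounded (U i) \<and> diameter (U i) \<le> \<delta>)}.
        \<Sum>i. if U i = {} then 0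
            else ennreal (unit_ball_vol (real k) * (diameter (U i) / 2) ^ k))"

definition hausdorff_outer_measure :: "nat \<Rightarrow> 'a::metric_space set \<Rightarrow> ennreal" where
  "hausdorff_outer_measure k A = (SUP \<delta> \<in> {0<..}. hausdorff_content k \<delta> A)"

definition hausdorff_measure :: "nat \<Rightarrow> 'a::metric_space measure" where
  "hausdorff_measure k = measure_of UNIV (sets borel) (hausdorff_outer_measure k)"

definition mass_center :: "'a::euclidean_space measure \<Rightarrow> 'a set \<Rightarrow> 'a" where
  "mass_center \<mu> A = (1 / measure \<mu> A) *\<^sub>R (LINT y:A|\<mu>. y)"

definition centroid :: "'a::euclidean_space set \<Rightarrow> 'a" where
  "centroid K = mass_center lborel K"

definition circumcenter :: "'a::euclidean_space set \<Rightarrow> 'a" where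
  "circumcenter K =
     (THE c. \<exists>r. K \<subseteq> cball c r \<and> (\<forall>c' r'. K \<subseteq> cball c' r' \<longrightarrow> r \<le> r'))"

definition inradius :: "'a::euclidean_space set \<Rightarrow> real" where
  "inradius K = (GREATEST r. 0 \<le> r \<and> (\<exists>x. cball x r \<subseteq> K))"

definition incenters :: "'a::euclidean_space set \<Rightarrow> 'a set" where
  "incenters K = {x \<in> K. infdist x (frontier K) = inradius K}"

definition incenters_centroid :: "'a::euclidean_space set \<Rightarrow> 'a" where
  "incenters_centroid K =
     (if aff_dim (incenters K) \<ge> 1
      then mass_center (hausdorff_measure (nat (aff_dim (incenters K)))) (incenters K)
      else (THE x. incenters K = {x}))"

text \<open>
  Reflection in the hyperplane \<open>{x. x \<bullet> \<omega> = l}\<close>; the formula is the reflection only for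
  unit vectors \<open>\<omega>\<close>.
\<close>

definition hyperplane_reflection :: "real \<Rightarrow> 'a::euclidean_space \<Rightarrow> 'a \<Rightarrow> 'a" where
  "hyperplane_reflection l \<omega> x = x + (2 * (l - x \<bullet> \<omega>)) *\<^sub>R \<omega>"

definition cap :: "'a::euclidean_space set \<Rightarrow> real \<Rightarrow> 'a \<Rightarrow> 'a set" where
  "cap K l \<omega> = {x \<in> K. x \<bullet> \<omega> \<ge> l}"

definition maximal_folding :: "'a::euclidean_space set \<Rightarrow> 'a \<Rightarrow> real" where
  "maximal_folding K \<omega> = (LEAST l. hyperplane_reflection l \<omega> ` cap K l \<omega> \<subseteq> K)"

definition heart :: "'a::euclidean_space set \<Rightarrow> 'a set" where
  "heart K = {x \<in> K. \<forall>\<omega> \<in> sphere 0 1. x \<bullet> \<omega> \<le> maximal_folding K \<omega>}"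

end

theory Submission
  imports Defs
begin

text \<open>
  The three centers all lie in the heart, and a bounded set has diameter at least the distance
  between any two of its points.

  For a unit vector \<open>\<omega>\<close>, the set of \<open>l\<close> such that the reflection \<open>T\<close> in \<open>x \<bullet> \<omega> = l\<close> folds the cap
  of \<open>K\<close> back into \<open>K\<close> is nonempty, closed and bounded below, so the maximal folding value belongs
  to it (\<open>folds_into_maximal_folding\<close>).  A point \<open>p\<close> of \<open>K\<close> is therefore in the heart as soon as
  \<open>p \<bullet> \<omega> \<le> l\<close> whenever the cap at height \<open>l\<close> folds into \<open>K\<close>.

  For a center of mass, the function \<open>g y = indicator A y * (y \<bullet> \<omega> - l)\<close> satisfies
  \<open>g + g \<circ> T \<le> 0\<close> whenever the cap of \<open>A\<close> folds into \<open>A\<close>.  If the measure is invariant under \<open>T\<close>, the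
  two summands have the same integral, hence the integral of \<open>g\<close> is at most \<open>0\<close>
  (\<open>mass_center_inner_le\<close>).  With Lebesgue measure this is the claim for the centroid.

  If the cap of \<open>K\<close> folds into \<open>K\<close>, the cap of the set of incenters folds into the set of incenters
  (\<open>folds_into_incenters\<close>), so the same inequality, now for the Hausdorff measure of dimension
  \<open>k = aff_dim (incenters K)\<close>, settles \<open>incenters_centroid K\<close>.  Here one has to know that the
  Hausdorff outer measure is countably additive on Borel sets, which is Caratheodory's criterion
  (\<open>closed_in_hausdorff_lambda_system\<close>), that it is invariant under isometries, and that it is
  positive and finite on a bounded convex set of dimension \<open>k\<close> (\<open>hausdorff_outer_convex\<close>);
  otherwise the average over the incenters would be meaningless.

  If the circumcenter \<open>c\<close> were strictly beyond the folding hyperplane, the ball of the same radius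
  about \<open>T c\<close> would also contain \<open>K\<close>, contradicting uniqueness of the smallest enclosing ball
  (\<open>circumcenter_mem_heart\<close>).
\<close>

section \<open>Reflections and folding\<close>

lemma reflection_inner:
  "norm \<omega> = 1 \<Longrightarrow> hyperplane_reflection l \<omega> x \<bullet> \<omega> = 2 * l - x \<bullet> \<omega>"
  by (simp add: hyperplane_reflection_def inner_add_left dot_square_norm)

lemma reflection_reflection [simp]:
  "norm \<omega> = 1 \<Longrightarrow> hyperplane_reflection l \<omega> (hyperplane_reflection l \<omega> x) = x"
  by (simp add: hyperplane_reflection_def inner_add_left dot_square_norm algebra_simps flip: scaleR_add_left)

text \<open>
  Two consequences of this identity carry the geometric arguments: a reflection preserves distances,
  and reflecting \<open>y\<close> cannot bring it closer to a point on its own side of the hyperplane.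
\<close>

lemma dist_reflection_sq:
  assumes "norm \<omega> = 1"
  shows "(dist x (hyperplane_reflection l \<omega> y))\<^sup>2 = (dist x y)\<^sup>2 + 4 * (l - x \<bullet> \<omega>) * (l - y \<bullet> \<omega>)"
proof -
  define s where "s = 2 * (l - y \<bullet> \<omega>)"
  have "(dist x (hyperplane_reflection l \<omega> y))\<^sup>2 = (norm ((x - y) - s *\<^sub>R \<omega>))\<^sup>2"
    by (simp add: dist_norm hyperplane_reflection_def s_def algebra_simps)
  also have "\<dots> = (norm (x - y))\<^sup>2 - 2 * s * ((x - y) \<bullet> \<omega>) + s\<^sup>2"
  proof -
    have "(norm (d - s *\<^sub>R \<omega>))\<^sup>2 = (norm d)\<^sup>2 - 2 * s * (d \<bullet> \<omega>) + s\<^sup>2" for d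
      using assms unfolding power2_norm_eq_inner norm_eq_1
      by (simp add: inner_diff_left inner_diff_right inner_commute power2_eq_square algebra_simps)
    then show ?thesis .
  qed
  also have "\<dots> = (dist x y)\<^sup>2 + 4 * (l - x \<bullet> \<omega>) * (l - y \<bullet> \<omega>)"
    by (simp add: dist_norm s_def inner_diff_left power2_eq_square algebra_simps)
  finally show ?thesis .
qed

lemma dist_reflection_ge:
  assumes "norm \<omega> = 1" "(l - x \<bullet> \<omega>) * (l - y \<bullet> \<omega>) \<ge> 0"
  shows "dist x y \<le> dist x (hyperplane_reflection l \<omega> y)"
proof -
  have "(dist x y)\<^sup>2 \<le> (dist x (hyperplane_reflection l \<omega> y))\<^sup>2"
    using assms dist_reflection_sq[of \<omega> x l y] by (simp only: mult.assoc)
  then show ?thesis by (rule power2_le_imp_le) simp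
qed

lemma dist_reflection_reflection:
  assumes "norm \<omega> = 1"
  shows "dist (hyperplane_reflection l \<omega> x) (hyperplane_reflection l \<omega> y) = dist x y"
proof -
  have "(dist (hyperplane_reflection l \<omega> x) (hyperplane_reflection l \<omega> y))\<^sup>2 = (dist x y)\<^sup>2"
    using assms dist_reflection_sq[OF assms, of "hyperplane_reflection l \<omega> x" l y]
      dist_reflection_sq[OF assms, of y l x]
    by (simp add: reflection_inner dist_commute algebra_simps)
  then show ?thesis by simp
qed

lemma continuous_reflection: "continuous_on S (hyperplane_reflection l \<omega>)"
  unfolding hyperplane_reflection_def by (intro continuous_intros)

lemma borel_measurable_reflection [measurable]: "hyperplane_reflection l \<omega> \<in> borel_measurable borel"
  by (intro borel_measurable_continuous_onI continuous_reflection)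

text \<open>
  The condition in the definition of the maximal folding function, stated pointwise.
\<close>

definition folds_into :: "'a::euclidean_space set \<Rightarrow> real \<Rightarrow> 'a \<Rightarrow> bool" where
  "folds_into K l \<omega> \<longleftrightarrow> (\<forall>x\<in>K. l \<le> x \<bullet> \<omega> \<longrightarrow> hyperplane_reflection l \<omega> x \<in> K)"

lemma folds_into_iff: "hyperplane_reflection l \<omega> ` cap K l \<omega> \<subseteq> K \<longleftrightarrow> folds_into K l \<omega>"
  by (auto simp: folds_into_def cap_def)

text \<open>
  The defining minimum is attained: if \<open>u n\<close> tends to \<open>l\<close> and the caps at height \<open>u n\<close> fold into
  \<open>K\<close>, then a point strictly above \<open>l\<close> is eventually in all these caps, and its reflections converge
  inside the closed set \<open>K\<close>; a point at height \<open>l\<close> is fixed by the limiting reflection.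
\<close>

lemma folds_into_maximal_folding:
  fixes K :: "'a::euclidean_space set"
  assumes "compact K" "K \<noteq> {}" and \<omega>: "norm \<omega> = 1"
  shows "folds_into K (maximal_folding K \<omega>) \<omega>"
proof -
  let ?S = "{l. folds_into K l \<omega>}"
  obtain R where R: "\<And>x. x \<in> K \<Longrightarrow> norm x \<le> R"
    using compact_imp_bounded[OF \<open>compact K\<close>] by (auto simp: bounded_iff)
  have bd: "\<bar>x \<bullet> \<omega>\<bar> \<le> R" if "x \<in> K" for x
    using Cauchy_Schwarz_ineq2[of x \<omega>] R[OF that] \<omega> by simp
  \<comment> \<open>The cap at height \<open>R + 1\<close> is empty.\<close>
  have "folds_into K (R + 1) \<omega>"
    using bd by (force simp: folds_into_def)
  then have ne: "?S \<noteq> {}" by blast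
  \<comment> \<open>If \<open>l\<close> does not exceed the height of some \<open>x\<close> in \<open>K\<close>, then \<open>l\<close> is the mean of the heights of \<open>x\<close> and
    of its reflection, both of which are in \<open>K\<close>.\<close>
  have below: "- R \<le> l" if "l \<in> ?S" for l
  proof -
    obtain x where x: "x \<in> K" using \<open>K \<noteq> {}\<close> by blast
    show ?thesis
    proof (cases "l \<le> x \<bullet> \<omega>")
      case True
      then have "hyperplane_reflection l \<omega> x \<in> K" using that x by (auto simp: folds_into_def)
      from bd[OF this] True show ?thesis using bd[OF x] by (simp add: reflection_inner \<omega>)
    next
      case False
      then show ?thesis using bd[OF x] by simp
    qed
  qed
  then have bdd: "bdd_below ?S" by (auto simp: bdd_below_def)
  have "closed ?S"
    unfolding closed_sequential_limits
  proof (intro allI impI CollectI; elim conjE)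
    fix u l assume u: "\<forall>n::nat. u n \<in> ?S" and lim: "u \<longlonglongrightarrow> l"
    show "folds_into K l \<omega>"
      unfolding folds_into_def
    proof (intro ballI impI)
      fix x assume x: "x \<in> K" "l \<le> x \<bullet> \<omega>"
      show "hyperplane_reflection l \<omega> x \<in> K"
      proof (cases "l = x \<bullet> \<omega>")
        case True
        then show ?thesis using x by (simp add: hyperplane_reflection_def)
      next
        case False
        then have "eventually (\<lambda>n. u n < x \<bullet> \<omega>) sequentially"
          using x lim by (intro order_tendstoD(2)) auto
        then have ev: "eventually (\<lambda>n. hyperplane_reflection (u n) \<omega> x \<in> K) sequentially"
          by eventually_elim (use u x in \<open>auto simp: folds_into_def\<close>)
        have "(\<lambda>n. hyperplane_reflection (u n) \<omega> x) \<longlonglongrightarrow> hyperplane_reflection l \<omega> x"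
          unfolding hyperplane_reflection_def by (intro tendsto_intros lim)
        then show ?thesis
          by (rule Lim_in_closed_set[OF compact_imp_closed[OF \<open>compact K\<close>] ev sequentially_bot])
      qed
    qed
  qed
  then have min: "Inf ?S \<in> ?S"
    using ne bdd by (intro closed_contains_Inf)
  have "maximal_folding K \<omega> = Inf ?S"
    unfolding maximal_folding_def folds_into_iff
    by (rule Least_equality) (use min bdd in \<open>auto intro: cInf_lower\<close>)
  with min show ?thesis by simp
qed

lemma mem_heartI:
  fixes K :: "'a::euclidean_space set"
  assumes "compact K" "p \<in> K"
    and "\<And>\<omega> l. norm \<omega> = 1 \<Longrightarrow> folds_into K l \<omega> \<Longrightarrow> p \<bullet> \<omega> \<le> l"
  shows "p \<in> heart K"
proof -
  have "p \<bullet> \<omega> \<le> maximal_folding K \<omega>" if "norm \<omega> = 1" for \<omega>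
    using that \<open>p \<in> K\<close> by (intro assms(3) folds_into_maximal_folding[OF \<open>compact K\<close>]) auto
  with \<open>p \<in> K\<close> show ?thesis by (auto simp: heart_def)
qed

section \<open>Centers of mass under folding\<close>

lemma
  fixes A :: "'a::euclidean_space set"
  assumes M: "sets M = sets borel" and A: "compact A" "emeasure M A < \<infinity>"
  shows integrable_indicator_inner: "integrable M (\<lambda>y. indicator A y * (y \<bullet> a))"
    and mass_center_inner: "mass_center M A \<bullet> a = (LINT y|M. indicator A y * (y \<bullet> a)) / measure M A"
proof -
  have A_M: "A \<in> sets M" using M A by (simp add: borel_compact)
  obtain R where R: "\<And>x. x \<in> A \<Longrightarrow> norm x \<le> R"
    using compact_imp_bounded[OF \<open>compact A\<close>] by (auto simp: bounded_iff)
  have int: "integrable M (\<lambda>y. indicator A y *\<^sub>R y)"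
    by (rule integrableI_bounded_set_indicator[OF A_M])
       (use M A R in \<open>auto simp: measurable_cong_sets[OF M refl]\<close>)
  have eq: "(\<lambda>y. indicator A y * (y \<bullet> a)) = (\<lambda>y. (indicator A y *\<^sub>R y) \<bullet> a)"
    by simp
  show "integrable M (\<lambda>y. indicator A y * (y \<bullet> a))"
    unfolding eq by (rule integrable_inner_left) (rule int)
  show "mass_center M A \<bullet> a = (LINT y|M. indicator A y * (y \<bullet> a)) / measure M A"
    unfolding eq using int
    by (simp add: mass_center_def set_lebesgue_integral_def integral_inner_left del: inner_scaleR_left)
       (simp add: divide_inverse mult.commute)
qed

text \<open>
  A point outside \<open>A\<close> is strictly separated from \<open>A\<close> by a hyperplane, but an average of points of \<open>A\<close>
  cannot be on the wrong side of it.
\<close>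

lemma mass_center_mem:
  fixes A :: "'a::euclidean_space set"
  assumes M: "sets M = sets borel" and A: "compact A" "convex A" "0 < emeasure M A" "emeasure M A < \<infinity>"
  shows "mass_center M A \<in> A"
proof (rule ccontr)
  assume "mass_center M A \<notin> A"
  then obtain a b where ab: "a \<bullet> mass_center M A < b" "\<And>x. x \<in> A \<Longrightarrow> b < a \<bullet> x"
    using separating_hyperplane_closed_point[of A "mass_center M A"] A compact_imp_closed by blast
  have A_M: "A \<in> sets M" using M A by (simp add: borel_compact)
  have pos: "measure M A > 0"
    using A by (simp add: measure_def enn2real_positive_iff less_top)
  have "b * measure M A = (LINT y|M. indicator A y * b)"
    using A_M by simp
  also have "\<dots> \<le> (LINT y|M. indicator A y * (y \<bullet> a))"
  proof (rule integral_mono)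
    show "integrable M (\<lambda>y. indicator A y * b)"
      using A_M A by (intro integrable_mult_left) (auto simp: less_top)
    show "integrable M (\<lambda>y. indicator A y * (y \<bullet> a))"
      by (rule integrable_indicator_inner) fact+
    show "indicator A x * b \<le> indicator A x * (x \<bullet> a)" for x
      using ab(2)[of x] by (auto simp: indicator_def inner_commute)
  qed
  finally have "b \<le> mass_center M A \<bullet> a"
    using pos by (simp add: mass_center_inner[OF M \<open>compact A\<close> \<open>emeasure M A < \<infinity>\<close>] pos_le_divide_eq)
  with ab(1) show False by (simp add: inner_commute)
qed

text \<open>
  Folding pairs each \<open>y\<close> above the hyperplane with its mirror image \<open>?T y\<close>, whose signed height is the
  opposite one.  Points of \<open>A\<close> above are matched by points of \<open>A\<close> below, so the mean signed height is
  at most \<open>0\<close>.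
\<close>

lemma mass_center_inner_le:
  fixes A :: "'a::euclidean_space set"
  assumes M: "sets M = sets borel" and A: "compact A" "0 < emeasure M A" "emeasure M A < \<infinity>"
    and \<omega>: "norm \<omega> = 1" and fold: "folds_into A l \<omega>"
    and inv: "distr M borel (hyperplane_reflection l \<omega>) = M"
  shows "mass_center M A \<bullet> \<omega> \<le> l"
proof -
  let ?T = "hyperplane_reflection l \<omega>"
  define g where "g y = indicator A y * (y \<bullet> \<omega> - l)" for y
  have A_M: "A \<in> sets M" and A_b: "A \<in> sets borel" using M A by (auto simp: borel_compact)
  have pos: "measure M A > 0"
    using A by (simp add: measure_def enn2real_positive_iff less_top)
  have int1: "integrable M (\<lambda>y. indicator A y * (y \<bullet> \<omega>))"
    by (rule integrable_indicator_inner) fact+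
  have int2: "integrable M (\<lambda>y. indicator A y * l)"
    using A_M A by (intro integrable_mult_left) (auto simp: less_top)
  have g_diff: "g = (\<lambda>y. indicator A y * (y \<bullet> \<omega>) - indicator A y * l)"
    by (auto simp: g_def algebra_simps)
  have int_g: "integrable M g"
    unfolding g_diff using int1 int2 by (rule Bochner_Integration.integrable_diff)
  have T_M: "?T \<in> M \<rightarrow>\<^sub>M borel"
    using borel_measurable_reflection measurable_cong_sets[OF M refl] by blast
  have g_b: "g \<in> borel_measurable borel"
    unfolding g_def using A_b by measurable
  have int_gT: "integrable M (\<lambda>y. g (?T y))"
    using int_g integrable_distr_eq[OF T_M g_b] by (simp add: inv)
  have "(LINT y|M. g y) = (LINT y|M. g (?T y))"
    using integral_distr[OF T_M g_b] by (simp add: inv)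
  then have "2 * (LINT y|M. g y) = (LINT y|M. g y + g (?T y))"
    using int_g int_gT by simp
  also have "\<dots> \<le> 0"
  proof -
    have "g y + g (?T y) \<le> 0" for y
    proof (cases "l \<le> y \<bullet> \<omega>")
      case True
      then show ?thesis
        using fold by (auto simp: g_def indicator_def reflection_inner \<omega> folds_into_def)
    next
      case False
      then have "y \<in> A" if "?T y \<in> A"
        using fold that reflection_reflection[OF \<omega>, of l y]
        by (force simp: folds_into_def reflection_inner \<omega>)
      then show ?thesis
        using False by (auto simp: g_def indicator_def reflection_inner \<omega>)
    qed
    then have "0 \<le> (LINT y|M. - (g y + g (?T y)))"
      by (intro Bochner_Integration.integral_nonneg) (simp only: neg_0_le_iff_le)
    then show ?thesis by (simp only: integral_minus neg_0_le_iff_le)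
  qed
  finally have "(LINT y|M. indicator A y * (y \<bullet> \<omega>)) - (LINT y|M. indicator A y * l) \<le> 0"
    using int1 int2 by (simp add: g_diff)
  then have "(LINT y|M. indicator A y * (y \<bullet> \<omega>)) \<le> l * measure M A"
    using A_M by (simp add: mult.commute)
  then show ?thesis
    using pos by (simp add: mass_center_inner[OF M \<open>compact A\<close> \<open>emeasure M A < \<infinity>\<close>] pos_divide_le_eq)
qed

text \<open>
  The image \<open>\<mu>\<close> of Lebesgue measure under \<open>f\<close> is again invariant under translations, because \<open>f\<close> is
  onto.  Two translation invariant \<open>\<sigma>\<close>-finite Borel measures are proportional, by computing the measure of
  \<open>{(x, y). y \<in> B \<and> x + y \<in> A}\<close> in both orders; the unit ball \<open>B\<close>, which \<open>f\<close> preserves, shows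
  that the factor is \<open>1\<close>.
\<close>

lemma distr_lborel_linear_isometry:
  fixes f :: "'a::euclidean_space \<Rightarrow> 'a"
  assumes "linear f" and norm_f: "\<And>x. norm (f x) = norm x"
  shows "distr lborel borel f = lborel"
proof -
  have f_meas [measurable]: "f \<in> borel_measurable borel"
    using \<open>linear f\<close> by (intro borel_measurable_continuous_onI linear_continuous_on) (simp add: linear_linear)
  define \<mu> where "\<mu> = distr lborel borel f"
  have sets_\<mu> [measurable_cong, simp]: "sets \<mu> = sets borel" and space_\<mu> [simp]: "space \<mu> = UNIV"
    by (auto simp: \<mu>_def)
  have ball: "emeasure \<mu> (ball 0 r) = emeasure lborel (ball 0 r :: 'a set)" for r
  proof -
    have "f -` ball 0 r = ball 0 r" by (auto simp: norm_f)
    then show ?thesis by (simp add: \<mu>_def emeasure_distr)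
  qed
  have "sigma_finite_measure \<mu>"
  proof
    show "\<exists>A. countable A \<and> A \<subseteq> sets \<mu> \<and> \<Union>A = space \<mu> \<and> (\<forall>a\<in>A. emeasure \<mu> a \<noteq> \<infinity>)"
    proof (intro exI[of _ "range (\<lambda>n::nat. ball 0 (real n))"] conjI)
      show "\<Union>(range (\<lambda>n::nat. ball 0 (real n) :: 'a set)) = space \<mu>"
        using reals_Archimedean2 by fastforce
      show "\<forall>a\<in>range (\<lambda>n::nat. ball 0 (real n)). emeasure \<mu> a \<noteq> \<infinity>"
        using emeasure_lborel_ball_finite[of "0::'a"] by (auto simp: ball less_top[symmetric])
    qed auto
  qed
  then interpret \<mu>: sigma_finite_measure \<mu> .
  interpret P: pair_sigma_finite \<mu> lborel ..
  have shift_lborel: "(\<integral>\<^sup>+x. h (c + x) \<partial>lborel) = (\<integral>\<^sup>+x. h x \<partial>lborel)"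
    if [measurable]: "h \<in> borel_measurable borel" for h :: "'a \<Rightarrow> ennreal" and c
    using nn_integral_distr[of "(+) c" lborel borel h] by (simp add: lborel_distr_plus)
  have "inj f"
    using \<open>linear f\<close> norm_f by (metis linear_injective_0 norm_eq_zero)
  then have "surj f"
    using \<open>linear f\<close> by (simp add: linear_injective_imp_surjective)
  have shift: "(\<integral>\<^sup>+x. h (c + x) \<partial>\<mu>) = (\<integral>\<^sup>+x. h x \<partial>\<mu>)"
    if [measurable]: "h \<in> borel_measurable borel" for h :: "'a \<Rightarrow> ennreal" and c
  proof -
    obtain d where d: "c = f d" using \<open>surj f\<close> by (meson surjD)
    have "(\<integral>\<^sup>+x. h (c + x) \<partial>\<mu>) = (\<integral>\<^sup>+x. h (f (d + x)) \<partial>lborel)"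
      by (simp add: \<mu>_def nn_integral_distr d linear_add[OF \<open>linear f\<close>])
    also have "\<dots> = (\<integral>\<^sup>+x. h (f x) \<partial>lborel)" by (rule shift_lborel) measurable
    finally show ?thesis by (simp add: \<mu>_def nn_integral_distr)
  qed
  define B where "B = (ball 0 1 :: 'a set)"
  have B [measurable]: "B \<in> sets borel" by (simp add: B_def)
  have B_pos: "0 < emeasure lborel B"
    unfolding B_def emeasure_ball[OF zero_le_one] by (simp add: unit_ball_vol_pos)
  have B_fin: "emeasure lborel B < \<infinity>"
    unfolding B_def by (rule emeasure_lborel_ball_finite)
  have "emeasure \<mu> A = emeasure lborel A" if A [measurable]: "A \<in> sets borel" for A
  proof -
    have "emeasure \<mu> A * emeasure lborel B = (\<integral>\<^sup>+y. (\<integral>\<^sup>+x. indicator B y * indicator A x \<partial>\<mu>) \<partial>lborel)"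
      by (simp add: nn_integral_cmult nn_integral_multc mult.commute)
    also have "\<dots> = (\<integral>\<^sup>+y. (\<integral>\<^sup>+x. indicator B y * indicator A (y + x) \<partial>\<mu>) \<partial>lborel)"
      by (intro nn_integral_cong shift[symmetric]) measurable
    also have "\<dots> = (\<integral>\<^sup>+x. (\<integral>\<^sup>+y. indicator B y * indicator A (y + x) \<partial>lborel) \<partial>\<mu>)"
      by (rule P.Fubini') measurable
    also have "\<dots> = (\<integral>\<^sup>+x. (\<integral>\<^sup>+y. indicator B (y - x) * indicator A y \<partial>lborel) \<partial>\<mu>)"
    proof (rule nn_integral_cong)
      fix x
      show "(\<integral>\<^sup>+y. indicator B y * indicator A (y + x) \<partial>lborel)
          = (\<integral>\<^sup>+y. indicator B (y - x) * indicator A y \<partial>lborel)"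
        using shift_lborel[of "\<lambda>y. indicator B (y - x) * indicator A y" x] by (simp add: add.commute)
    qed
    also have "\<dots> = (\<integral>\<^sup>+y. (\<integral>\<^sup>+x. indicator B (y - x) * indicator A y \<partial>\<mu>) \<partial>lborel)"
      by (rule P.Fubini'[symmetric]) measurable
    also have "\<dots> = (\<integral>\<^sup>+y. (\<integral>\<^sup>+x. indicator B x * indicator A y \<partial>\<mu>) \<partial>lborel)"
    proof (rule nn_integral_cong)
      fix y
      \<comment> \<open>The ball is symmetric about \<open>0\<close>.\<close>
      have "(\<integral>\<^sup>+x. indicator B (y - x) * indicator A y \<partial>\<mu>) = (\<integral>\<^sup>+x. indicator B (- y + x) * indicator A y \<partial>\<mu>)"
        by (intro nn_integral_cong) (auto simp: B_def indicator_def norm_minus_commute)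
      also have "\<dots> = (\<integral>\<^sup>+x. indicator B x * indicator A y \<partial>\<mu>)"
        by (rule shift) measurable
      finally show "(\<integral>\<^sup>+x. indicator B (y - x) * indicator A y \<partial>\<mu>) = (\<integral>\<^sup>+x. indicator B x * indicator A y \<partial>\<mu>)" .
    qed
    also have "\<dots> = emeasure \<mu> B * emeasure lborel A"
      by (simp add: nn_integral_cmult nn_integral_multc)
    also have "emeasure \<mu> B = emeasure lborel B" by (simp add: B_def ball)
    finally have "emeasure lborel B * emeasure \<mu> A = emeasure lborel B * emeasure lborel A"
      by (simp only: mult.commute)
    then show ?thesis
      using B_pos B_fin by (auto simp: ennreal_mult_cancel_left)
  qed
  then show ?thesis
    unfolding \<mu>_def[symmetric] by (intro measure_eqI) auto
qed

lemma distr_lborel_reflection: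
  fixes \<omega> :: "'a::euclidean_space"
  assumes \<omega>: "norm \<omega> = 1"
  shows "distr lborel borel (hyperplane_reflection l \<omega>) = lborel"
proof -
  let ?f = "hyperplane_reflection 0 \<omega>"
  have "linear ?f"
    by (rule linearI) (auto simp: hyperplane_reflection_def inner_add_left algebra_simps)
  moreover have "norm (?f x) = norm x" for x
    using dist_reflection_reflection[OF \<omega>, of 0 x 0] by (simp add: hyperplane_reflection_def)
  ultimately have f: "distr lborel borel ?f = lborel" by (rule distr_lborel_linear_isometry)
  have eq: "hyperplane_reflection l \<omega> = (+) ((2 * l) *\<^sub>R \<omega>) \<circ> ?f"
    by (auto simp: hyperplane_reflection_def algebra_simps)
  have "distr lborel borel (hyperplane_reflection l \<omega>) = distr (distr lborel borel ?f) borel ((+) ((2 * l) *\<^sub>R \<omega>))"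
    unfolding eq by (subst distr_distr) auto
  then show ?thesis by (simp add: f lborel_distr_plus)
qed

lemma centroid_mem_heart:
  fixes K :: "'a::euclidean_space set"
  assumes "convex_body K"
  shows "centroid K \<in> heart K"
proof -
  have K: "compact K" "convex K" "interior K \<noteq> {}" using assms by (auto simp: convex_body_def)
  then obtain c e where ce: "e > 0" "ball c e \<subseteq> K" by (metis ex_in_conv mem_interior)
  have pos: "0 < emeasure lborel K"
  proof -
    have "0 < emeasure lborel (ball c e)"
      using ce(1) by (simp add: emeasure_ball unit_ball_vol_pos)
    also have "\<dots> \<le> emeasure lborel K"
      using ce K by (intro emeasure_mono) (auto simp: borel_compact)
    finally show ?thesis .
  qed
  have fin: "emeasure lborel K < \<infinity>"
    using compact_imp_bounded[OF K(1)] by (rule emeasure_bounded_finite)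
  show ?thesis
    unfolding centroid_def
  proof (rule mem_heartI[OF K(1)])
    show "mass_center lborel K \<in> K"
      using K pos fin by (intro mass_center_mem) auto
    show "mass_center lborel K \<bullet> \<omega> \<le> l" if "norm \<omega> = 1" "folds_into K l \<omega>" for \<omega> l
      using K pos fin that by (intro mass_center_inner_le distr_lborel_reflection) auto
  qed
qed

section \<open>The Hausdorff measure is a Borel measure\<close>

text \<open>
  The contribution of one covering set to the sums that define the Hausdorff content.
\<close>

definition diameter_weight :: "nat \<Rightarrow> 'a::metric_space set \<Rightarrow> ennreal" where
  "diameter_weight k U =
     (if U = {} then 0 else ennreal (unit_ball_vol (real k) * (diameter U / 2) ^ k))"

definition fine_cover :: "real \<Rightarrow> 'a::metric_space set \<Rightarrow> (nat \<Rightarrow> 'a set) \<Rightarrow> bool" where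
  "fine_cover \<delta> A U \<longleftrightarrow> A \<subseteq> (\<Union>i. U i) \<and> (\<forall>i. bounded (U i) \<and> diameter (U i) \<le> \<delta>)"

lemma hausdorff_content_alt:
  "hausdorff_content k \<delta> A = (INF U \<in> {U. fine_cover \<delta> A U}. \<Sum>i. diameter_weight k (U i))"
  by (simp add: hausdorff_content_def diameter_weight_def fine_cover_def)

lemma diameter_weight_empty [simp]: "diameter_weight k {} = 0"
  by (simp add: diameter_weight_def)

lemma diameter_weight_le:
  fixes U :: "'a::metric_space set"
  assumes "bounded U" "diameter U \<le> d"
  shows "diameter_weight k U \<le> ennreal (unit_ball_vol (real k) * (d / 2) ^ k)"
  using assms diameter_ge_0[of U]
  by (auto simp: diameter_weight_def intro!: ennreal_leI mult_left_mono power_mono)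

lemma diameter_weight_mono:
  fixes U V :: "'a::metric_space set"
  assumes "U \<subseteq> V" "bounded V"
  shows "diameter_weight k U \<le> diameter_weight k V"
proof (cases "U = {}")
  case False
  with assms have "diameter_weight k V = ennreal (unit_ball_vol (real k) * (diameter V / 2) ^ k)"
    by (auto simp: diameter_weight_def)
  with assms show ?thesis
    by (metis diameter_weight_le diameter_subset bounded_subset)
qed simp

lemma hausdorff_content_le:
  "fine_cover \<delta> A U \<Longrightarrow> hausdorff_content k \<delta> A \<le> (\<Sum>i. diameter_weight k (U i))"
  by (auto simp: hausdorff_content_alt intro: INF_lower)

lemma hausdorff_content_greatest:
  "(\<And>U. fine_cover \<delta> A U \<Longrightarrow> x \<le> (\<Sum>i. diameter_weight k (U i))) \<Longrightarrow> x \<le> hausdorff_content k \<delta> A"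
  by (auto simp: hausdorff_content_alt intro: INF_greatest)

lemma hausdorff_content_close:
  assumes "hausdorff_content k \<delta> A < x"
  obtains U where "fine_cover \<delta> A U" "(\<Sum>i. diameter_weight k (U i)) < x"
  using assms by (auto simp: hausdorff_content_alt INF_less_iff)

lemma hausdorff_content_mono:
  "A \<subseteq> B \<Longrightarrow> hausdorff_content k \<delta> A \<le> hausdorff_content k \<delta> B"
  by (rule hausdorff_content_greatest, rule hausdorff_content_le) (auto simp: fine_cover_def)

lemma hausdorff_content_antimono:
  "\<delta> \<le> \<epsilon> \<Longrightarrow> hausdorff_content k \<epsilon> A \<le> hausdorff_content k \<delta> A"
  by (rule hausdorff_content_greatest, rule hausdorff_content_le)
     (auto simp: fine_cover_def intro: order_trans)

lemma hausdorff_content_empty: "\<delta> > 0 \<Longrightarrow> hausdorff_content k \<delta> {} = 0"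
  using hausdorff_content_le[of \<delta> "{}" "\<lambda>_. {}" k] by (simp add: fine_cover_def)

text \<open>
  Near-optimal covers of the \<open>A i\<close>, with errors \<open>e / 2 ^ (i + 1)\<close>, are merged into one cover of the
  union along a pairing of the natural numbers.
\<close>

lemma hausdorff_content_countably_subadditive:
  "hausdorff_content k \<delta> (\<Union>i. A i) \<le> (\<Sum>i. hausdorff_content k \<delta> (A i))"
proof (rule ennreal_le_epsilon)
  fix b and e :: real assume "0 < e" "(\<Sum>n. hausdorff_content k \<delta> (A n)) < top"
  then have *: "\<And>n. hausdorff_content k \<delta> (A n) < hausdorff_content k \<delta> (A n) + e * (1/2)^Suc n"
    by (auto simp add: less_top dest!: ennreal_suminf_lessD)
  have "\<exists>B. fine_cover \<delta> (A n) B \<and>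
      (\<Sum>i. diameter_weight k (B i)) \<le> hausdorff_content k \<delta> (A n) + e * (1/2)^Suc n" for n
    by (metis hausdorff_content_close[OF *] less_imp_le)
  then obtain B where B: "\<And>n. fine_cover \<delta> (A n) (B n)"
      and Ble: "\<And>n. (\<Sum>i. diameter_weight k (B n i)) \<le> hausdorff_content k \<delta> (A n) + e * (1/2)^Suc n"
    by metis
  define C where "C = case_prod B o prod_decode"
  have "fine_cover \<delta> (\<Union>i. A i) C"
    unfolding fine_cover_def
  proof (intro conjI allI subsetI)
    fix x assume "x \<in> (\<Union>i. A i)"
    then obtain n i where "x \<in> B n i" using B unfolding fine_cover_def by blast
    then have "x \<in> C (prod_encode (n, i))" by (simp add: C_def)
    then show "x \<in> (\<Union>i. C i)" by blast
  qed (use B in \<open>auto simp: C_def fine_cover_def split: prod.split\<close>)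
  then have "hausdorff_content k \<delta> (\<Union>i. A i) \<le> (\<Sum>i. diameter_weight k (C i))"
    by (rule hausdorff_content_le)
  also have "\<dots> = (\<Sum>i. (case_prod (\<lambda>n i. diameter_weight k (B n i)) \<circ> prod_decode) i)"
    by (simp add: C_def comp_def split_beta)
  also have "\<dots> = (\<Sum>n. \<Sum>i. diameter_weight k (B n i))"
    unfolding comp_def by (intro suminf_ennreal_2dimen) auto
  also have "\<dots> \<le> (\<Sum>n. hausdorff_content k \<delta> (A n) + e * (1/2) ^ Suc n)"
    by (intro suminf_le suminf_nonneg allI Ble) auto
  also have "... = (\<Sum>n. hausdorff_content k \<delta> (A n)) + (\<Sum>n. ennreal e * ennreal ((1/2) ^ Suc n))"
    using \<open>0 < e\<close> by (subst suminf_add[symmetric])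
                     (auto simp del: ennreal_suminf_cmult simp add: ennreal_mult[symmetric])
  also have "\<dots> = (\<Sum>n. hausdorff_content k \<delta> (A n)) + e"
    unfolding ennreal_suminf_cmult
    by (subst suminf_ennreal_eq[OF zero_le_power power_half_series]) auto
  finally show "hausdorff_content k \<delta> (\<Union>i. A i) \<le> (\<Sum>n. hausdorff_content k \<delta> (A n)) + e" .
qed

lemma hausdorff_content_le_outer:
  "\<delta> > 0 \<Longrightarrow> hausdorff_content k \<delta> A \<le> hausdorff_outer_measure k A"
  by (auto simp: hausdorff_outer_measure_def intro: SUP_upper)

lemma hausdorff_outer_least:
  "(\<And>\<delta>. \<delta> > 0 \<Longrightarrow> hausdorff_content k \<delta> A \<le> x) \<Longrightarrow> hausdorff_outer_measure k A \<le> x"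
  by (auto simp: hausdorff_outer_measure_def intro: SUP_least)

lemma hausdorff_outer_mono:
  "A \<subseteq> B \<Longrightarrow> hausdorff_outer_measure k A \<le> hausdorff_outer_measure k B"
  by (meson hausdorff_outer_least hausdorff_content_le_outer hausdorff_content_mono order_trans)

lemma hausdorff_outer_empty [simp]: "hausdorff_outer_measure k {} = 0"
  by (simp add: hausdorff_outer_measure_def hausdorff_content_empty)

lemma hausdorff_outer_countably_subadditive:
  "hausdorff_outer_measure k (\<Union>i. A i) \<le> (\<Sum>i. hausdorff_outer_measure k (A i))"
  by (rule hausdorff_outer_least, rule order_trans[OF hausdorff_content_countably_subadditive])
     (auto intro!: suminf_le hausdorff_content_le_outer)

lemma outer_measure_space_hausdorff:
  "outer_measure_space UNIV (hausdorff_outer_measure k)"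
  by (auto simp: outer_measure_space_def positive_def increasing_def countably_subadditive_def
      intro: hausdorff_outer_mono hausdorff_outer_countably_subadditive)

lemma hausdorff_outer_subadditive:
  "hausdorff_outer_measure k (A \<union> B) \<le> hausdorff_outer_measure k A + hausdorff_outer_measure k B"
  using hausdorff_outer_countably_subadditive[of k "binaryset A B"]
    suminf_binaryset_eq[of "hausdorff_outer_measure k" A B] by (simp add: UN_binaryset_eq)

text \<open>
  A set of diameter less than \<open>d\<close> meets at most one of \<open>A\<close> and \<open>B\<close>, so a cover of \<open>A \<union> B\<close> by such
  sets splits into a cover of \<open>A\<close> and a cover of \<open>B\<close> at no additional cost.
\<close>

lemma hausdorff_outer_Un_separated:
  assumes "d > 0" and sep: "\<And>a b. a \<in> A \<Longrightarrow> b \<in> B \<Longrightarrow> d \<le> dist a b"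
  shows "hausdorff_outer_measure k A + hausdorff_outer_measure k B \<le> hausdorff_outer_measure k (A \<union> B)"
proof -
  have fine: "hausdorff_content k \<delta> A + hausdorff_content k \<delta> B \<le> hausdorff_content k \<delta> (A \<union> B)"
    if "\<delta> < d" for \<delta>
  proof (rule hausdorff_content_greatest)
    fix U assume U: "fine_cover \<delta> (A \<union> B) U"
    have sub: "fine_cover \<delta> C (\<lambda>i. U i \<inter> C)" if "C \<subseteq> A \<union> B" for C
      unfolding fine_cover_def
    proof (intro conjI allI)
      show "C \<subseteq> (\<Union>i. U i \<inter> C)" using U that by (auto simp: fine_cover_def)
      fix i
      show "bounded (U i \<inter> C)" using U by (auto simp: fine_cover_def intro: bounded_subset)
      have "diameter (U i \<inter> C) \<le> diameter (U i)"
        using U by (intro diameter_subset) (auto simp: fine_cover_def)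
      with U show "diameter (U i \<inter> C) \<le> \<delta>" by (auto simp: fine_cover_def intro: order_trans)
    qed
    have one: "diameter_weight k (U i \<inter> A) + diameter_weight k (U i \<inter> B) \<le> diameter_weight k (U i)" for i
    proof -
      have bU: "bounded (U i)" "diameter (U i) < d"
        using U \<open>\<delta> < d\<close> by (auto simp: fine_cover_def intro: le_less_trans)
      then have "U i \<inter> A = {} \<or> U i \<inter> B = {}"
        using sep diameter_bounded_bound[OF bU(1)] by (fastforce simp: disjoint_iff)
      then show ?thesis
        using diameter_weight_mono[OF _ bU(1)] by auto
    qed
    have "hausdorff_content k \<delta> A + hausdorff_content k \<delta> B
        \<le> (\<Sum>i. diameter_weight k (U i \<inter> A)) + (\<Sum>i. diameter_weight k (U i \<inter> B))"
      by (intro add_mono hausdorff_content_le sub) auto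
    also have "\<dots> = (\<Sum>i. diameter_weight k (U i \<inter> A) + diameter_weight k (U i \<inter> B))"
      by (rule suminf_add) auto
    also have "\<dots> \<le> (\<Sum>i. diameter_weight k (U i))"
      by (intro suminf_le one) auto
    finally show "hausdorff_content k \<delta> A + hausdorff_content k \<delta> B \<le> (\<Sum>i. diameter_weight k (U i))" .
  qed
  \<comment> \<open>Contents increase as \<open>\<delta>\<close> decreases, so both suprema may be taken along the same \<open>\<delta>\<close>.\<close>
  have "hausdorff_outer_measure k A + hausdorff_outer_measure k B =
      (SUP \<delta>\<in>{0<..}. hausdorff_content k \<delta> A + hausdorff_content k \<delta> B)"
    unfolding hausdorff_outer_measure_def
  proof (rule SUP_add_directed_ennreal[symmetric])
    fix i j :: real assume "i \<in> {0<..}" "j \<in> {0<..}"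
    then show "\<exists>l\<in>{0<..}. hausdorff_content k i A + hausdorff_content k j B
        \<le> hausdorff_content k l A + hausdorff_content k l B"
      by (intro bexI[of _ "min i j"] add_mono hausdorff_content_antimono) auto
  qed
  also have "\<dots> \<le> hausdorff_outer_measure k (A \<union> B)"
  proof (rule SUP_least)
    fix \<delta> :: real assume \<delta>: "\<delta> \<in> {0<..}"
    define \<epsilon> where "\<epsilon> = min \<delta> (d/2)"
    have \<epsilon>: "0 < \<epsilon>" "\<epsilon> \<le> \<delta>" "\<epsilon> < d" using \<delta> \<open>d > 0\<close> by (auto simp: \<epsilon>_def)
    have "hausdorff_content k \<delta> A + hausdorff_content k \<delta> B
        \<le> hausdorff_content k \<epsilon> A + hausdorff_content k \<epsilon> B"
      using \<epsilon> by (intro add_mono hausdorff_content_antimono)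
    also have "\<dots> \<le> hausdorff_content k \<epsilon> (A \<union> B)" by (rule fine) fact
    also have "\<dots> \<le> hausdorff_outer_measure k (A \<union> B)"
      using \<epsilon> by (intro hausdorff_content_le_outer)
    finally show "hausdorff_content k \<delta> A + hausdorff_content k \<delta> B \<le> hausdorff_outer_measure k (A \<union> B)" .
  qed
  finally show ?thesis .
qed

lemma ennreal_suminf_tail:
  fixes f :: "nat \<Rightarrow> ennreal"
  assumes "suminf f < \<infinity>" "e > 0"
  shows "\<exists>n. (\<Sum>i. f (i + n)) \<le> ennreal e"
proof -
  have "(\<lambda>n. sum f {..<n}) \<longlonglongrightarrow> suminf f"
    by (rule summable_LIMSEQ) simp
  then have "(\<lambda>n. sum f {..<n} + e) \<longlonglongrightarrow> suminf f + e"
    by (intro tendsto_add tendsto_const)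
  moreover have "suminf f < suminf f + e"
    using assms by (simp add: less_top)
  ultimately have "eventually (\<lambda>n. suminf f < sum f {..<n} + e) sequentially"
    by (rule order_tendstoD(1))
  then obtain n where n: "suminf f < sum f {..<n} + e"
    by (auto simp: eventually_sequentially)
  have fin: "sum f {..<n} < top"
    by (rule le_less_trans[OF sum_le_suminf]) (use assms(1) in auto)
  have "sum f {..<n} + (\<Sum>i. f (i + n)) = suminf f"
    using suminf_offset[of f n] by (simp add: add.commute)
  with n have "sum f {..<n} + (\<Sum>i. f (i + n)) \<le> sum f {..<n} + e"
    by simp
  with fin have "(\<Sum>i. f (i + n)) \<le> ennreal e"
    unfolding ennreal_add_left_cancel_le by fastforce
  then show ?thesis ..
qed


text \<open>
  Caratheodory's criterion: an outer measure that is additive on sets at positive distance measures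
  every closed set \<open>F\<close>.  The part \<open>Y m\<close> of \<open>X\<close> at distance at least \<open>\<rho> m\<close> from \<open>F\<close> is separated from
  \<open>X \<inter> F\<close>, and \<open>X - F\<close> is \<open>Y m\<close> together with the shells \<open>R n\<close> for \<open>n \<ge> m\<close>.  Shells whose indices
  differ by at least \<open>2\<close> are separated from each other, so the even shells and the odd shells each
  have total measure at most that of \<open>X\<close>.  The series over all shells thus converges and its tails
  are negligible.
\<close>

lemma closed_in_hausdorff_lambda_system:
  fixes F :: "'a::metric_space set"
  assumes "closed F"
  shows "F \<in> lambda_system UNIV UNIV (hausdorff_outer_measure k)"
proof (cases "F = {}")
  case True
  then show ?thesis by (simp add: lambda_system_def)
next
  case False
  let ?H = "hausdorff_outer_measure k :: 'a set \<Rightarrow> ennreal"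
  have le: "?H (X \<inter> F) + ?H (X - F) \<le> ?H X" for X
  proof (cases "?H X = \<infinity>")
    case fin: False
    define \<rho> where "\<rho> n = 1 / real (Suc n)" for n
    have \<rho>_pos: "\<rho> n > 0" and \<rho>_Suc: "\<rho> (Suc n) < \<rho> n" for n
      by (auto simp: \<rho>_def field_simps)
    have \<rho>_le: "\<rho> n \<le> \<rho> m" if "m \<le> n" for m n
      using that by (auto simp: \<rho>_def field_simps)
    have \<rho>_ex: "\<exists>n. \<rho> n \<le> d" if "d > 0" for d
      using that unfolding \<rho>_def by (metis inverse_eq_divide less_imp_le reals_Archimedean)
    define Y where "Y n = {x \<in> X. \<rho> n \<le> infdist x F}" for n
    define R where "R n = {x \<in> X. \<rho> (Suc n) \<le> infdist x F \<and> infdist x F < \<rho> n}" for n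
    have shell: "\<exists>n\<ge>m. x \<in> R n" if "x \<in> X - F" "x \<notin> Y m" for x m
    proof -
      have "infdist x F > 0"
        using that assms False by (simp add: infdist_pos_not_in_closed)
      then have ex: "\<exists>n. \<rho> n \<le> infdist x F" by (rule \<rho>_ex)
      define n where "n = (LEAST n. \<rho> n \<le> infdist x F)"
      have n: "\<rho> n \<le> infdist x F" unfolding n_def by (rule LeastI_ex) (rule ex)
      have below: "infdist x F < \<rho> j" if "j < n" for j
        using not_less_Least[OF that[unfolded n_def]] by simp
      have "m < n"
      proof (rule ccontr)
        assume "\<not> m < n"
        then have "\<rho> m \<le> infdist x F" using n \<rho>_le[of n m] by linarith
        with that show False by (auto simp: Y_def)
      qed
      then obtain p where p: "n = Suc p" "m \<le> p" by (metis less_imp_Suc_add le_add1)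
      then show ?thesis using n below[of p] that by (auto simp: R_def)
    qed
    have sep_R: "\<rho> (Suc i) - \<rho> j \<le> dist x y" if "x \<in> R i" "y \<in> R j" for i j x y
      using that infdist_triangle[of x F y] by (auto simp: R_def)
    \<comment> \<open>The cases \<open>c = 0\<close> and \<open>c = 1\<close> are the even and the odd shells.\<close>
    have partial: "(\<Sum>i<n. ?H (R (2 * i + c))) \<le> ?H X" for n c
    proof -
      have "(\<Sum>i<n. ?H (R (2 * i + c))) \<le> ?H (\<Union>i<n. R (2 * i + c))"
      proof (induction n)
        case (Suc n)
        have "?H (\<Union>i<n. R (2 * i + c)) + ?H (R (2 * n + c))
            \<le> ?H ((\<Union>i<n. R (2 * i + c)) \<union> R (2 * n + c))"
        proof (cases n)
          case (Suc m)
          show ?thesis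
          proof (rule hausdorff_outer_Un_separated)
            show "0 < \<rho> (2 * m + c + 1) - \<rho> (2 * n + c)"
              using \<rho>_Suc[of "2 * m + c + 1"] by (simp add: Suc)
            fix a b assume "a \<in> (\<Union>i<n. R (2 * i + c))" "b \<in> R (2 * n + c)"
            then obtain i where "i \<le> m" "a \<in> R (2 * i + c)" unfolding Suc by (auto simp: less_Suc_eq_le)
            with \<open>b \<in> _\<close> have "\<rho> (Suc (2 * i + c)) - \<rho> (2 * n + c) \<le> dist a b" by (intro sep_R)
            moreover have "\<rho> (2 * m + c + 1) \<le> \<rho> (Suc (2 * i + c))"
              using \<open>i \<le> m\<close> by (intro \<rho>_le) auto
            ultimately show "\<rho> (2 * m + c + 1) - \<rho> (2 * n + c) \<le> dist a b" by linarith
          qed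
        qed simp
        then show ?case
          using Suc.IH by (simp add: lessThan_Suc Un_commute add.commute) (meson add_left_mono order_trans)
      qed simp
      also have "\<dots> \<le> ?H X" by (rule hausdorff_outer_mono) (auto simp: R_def)
      finally show ?thesis .
    qed
    have "(\<Sum>i. ?H (R i)) \<le> ?H X + ?H X"
    proof (rule suminf_le_const)
      fix n
      have "(\<Sum>i<n. ?H (R i)) \<le> (\<Sum>i<2 * n. ?H (R i))"
        by (rule sum_mono2) auto
      also have "\<dots> = (\<Sum>i<n. ?H (R (2 * i + 0))) + (\<Sum>i<n. ?H (R (2 * i + 1)))"
        by (induction n) (auto simp: algebra_simps)
      also have "\<dots> \<le> ?H X + ?H X" by (intro add_mono partial)
      finally show "(\<Sum>i<n. ?H (R i)) \<le> ?H X + ?H X" .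
    qed simp
    also have "\<dots> < \<infinity>" using fin by (simp add: less_top)
    finally have fin_R: "(\<Sum>i. ?H (R i)) < \<infinity>" .
    show ?thesis
    proof (rule ennreal_le_epsilon)
      fix e :: real assume "e > 0"
      then obtain m where m: "(\<Sum>i. ?H (R (i + m))) \<le> ennreal e"
        using ennreal_suminf_tail[OF fin_R] by blast
      have "X - F \<subseteq> Y m \<union> (\<Union>i. R (i + m))"
      proof
        fix x assume x: "x \<in> X - F"
        show "x \<in> Y m \<union> (\<Union>i. R (i + m))"
        proof (cases "x \<in> Y m")
          case False
          then obtain n where "n \<ge> m" "x \<in> R n" using shell x by blast
          then have "x \<in> R ((n - m) + m)" by simp
          then show ?thesis by blast
        qed simp
      qed
      then have "?H (X - F) \<le> ?H (Y m \<union> (\<Union>i. R (i + m)))" by (rule hausdorff_outer_mono)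
      also have "\<dots> \<le> ?H (Y m) + ?H (\<Union>i. R (i + m))" by (rule hausdorff_outer_subadditive)
      also have "\<dots> \<le> ?H (Y m) + e"
        using hausdorff_outer_countably_subadditive[of k "\<lambda>i. R (i + m)"] m
        by (intro add_left_mono) (rule order_trans)
      finally have "?H (X \<inter> F) + ?H (X - F) \<le> (?H (X \<inter> F) + ?H (Y m)) + e"
        by (simp add: add.assoc add_left_mono)
      also have "?H (X \<inter> F) + ?H (Y m) \<le> ?H ((X \<inter> F) \<union> Y m)"
      proof (rule hausdorff_outer_Un_separated[OF \<rho>_pos[of m]])
        fix a b assume "a \<in> X \<inter> F" "b \<in> Y m"
        then show "\<rho> m \<le> dist a b"
          using infdist_le[of a F b] by (auto simp: Y_def dist_commute)
      qed
      also have "\<dots> \<le> ?H X" by (rule hausdorff_outer_mono) (auto simp: Y_def)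
      finally show "?H (X \<inter> F) + ?H (X - F) \<le> ?H X + e" by (simp add: add_right_mono)
    qed
  qed simp
  have ge: "?H X \<le> ?H (X \<inter> F) + ?H (X - F)" for X
    using hausdorff_outer_subadditive[of k "X \<inter> F" "X - F"] by (simp add: Int_Diff_Un)
  have "?H (F \<inter> X) + ?H ((UNIV - F) \<inter> X) = ?H X" for X
  proof -
    have "F \<inter> X = X \<inter> F" "(UNIV - F) \<inter> X = X - F" by auto
    then show ?thesis using le[of X] ge[of X] by simp
  qed
  then show ?thesis by (simp add: lambda_system_def)
qed

lemma sets_hausdorff_measure [simp, measurable_cong]: "sets (hausdorff_measure k) = sets borel"
  unfolding hausdorff_measure_def by (metis sets.sigma_sets_eq sets_measure_of space_borel sets.space_closed)

proposition emeasure_hausdorff_measure: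
  fixes A :: "'a::metric_space set"
  assumes "A \<in> sets borel"
  shows "emeasure (hausdorff_measure k) A = hausdorff_outer_measure k A"
proof -
  let ?H = "hausdorff_outer_measure k :: 'a set \<Rightarrow> ennreal"
  let ?L = "lambda_system UNIV UNIV ?H"
  interpret S: sigma_algebra UNIV "UNIV :: 'a set set"
    by (metis Pow_UNIV sigma_algebra_Pow)
  have L: "measure_space UNIV ?L ?H"
    by (rule S.caratheodory_lemma[OF outer_measure_space_hausdorff])
  then interpret L: sigma_algebra UNIV ?L
    by (simp add: measure_space_def)
  have "sets (borel :: 'a measure) = sigma_sets UNIV (Collect closed)"
    unfolding borel_eq_closed by simp
  also have "\<dots> \<subseteq> ?L"
    by (rule L.sigma_sets_subset) (auto intro: closed_in_hausdorff_lambda_system)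
  finally have "sets (borel :: 'a measure) \<subseteq> ?L" .
  then have "positive (sets borel) ?H" "countably_additive (sets borel) ?H"
    using L by (auto simp: measure_space_def positive_def countably_additive_def)
  then show ?thesis
    unfolding hausdorff_measure_def
    using assms sets.sigma_algebra_axioms[of "borel :: 'a measure"]
    by (intro emeasure_measure_of_sigma) auto
qed

text \<open>
  A contraction maps each cover of \<open>A\<close> to a cover of the image by sets of no larger diameter.
\<close>

lemma hausdorff_outer_image_le:
  fixes f :: "'a::metric_space \<Rightarrow> 'b::metric_space"
  assumes f: "\<And>x y. x \<in> A \<Longrightarrow> y \<in> A \<Longrightarrow> dist (f x) (f y) \<le> dist x y"
  shows "hausdorff_outer_measure k (f ` A) \<le> hausdorff_outer_measure k A"
proof (rule hausdorff_outer_least)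
  fix \<delta> :: real assume "\<delta> > 0"
  have "hausdorff_content k \<delta> (f ` A) \<le> hausdorff_content k \<delta> A"
  proof (rule hausdorff_content_greatest)
    fix U assume U: "fine_cover \<delta> A U"
    define V where "V i = f ` (U i \<inter> A)" for i
    have V: "bounded (V i) \<and> diameter (V i) \<le> diameter (U i)" for i
    proof -
      have bU: "bounded (U i)" using U by (auto simp: fine_cover_def)
      have d: "dist p q \<le> diameter (U i)" if "p \<in> V i" "q \<in> V i" for p q
      proof -
        obtain x y where xy: "p = f x" "q = f y" "x \<in> U i" "y \<in> U i" "x \<in> A" "y \<in> A"
          using \<open>p \<in> V i\<close> \<open>q \<in> V i\<close> by (auto simp: V_def)
        then show ?thesis
          using f[of x y] diameter_bounded_bound[OF bU, of x y] by simp
      qed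
      have "bounded (V i)"
        unfolding bounded_two_points using d by blast
      moreover have "diameter (V i) \<le> diameter (U i)"
      proof (cases "V i = {}")
        case False
        then have "diameter (V i) = (SUP (p, q)\<in>V i \<times> V i. dist p q)"
          by (simp add: diameter_def)
        also have "\<dots> \<le> diameter (U i)"
          using False d by (intro cSUP_least) auto
        finally show ?thesis .
      qed (simp add: diameter_ge_0[OF bU])
      ultimately show ?thesis by blast
    qed
    have "fine_cover \<delta> (f ` A) V"
      using U V unfolding fine_cover_def by (fastforce simp: V_def intro: order_trans)
    then have "hausdorff_content k \<delta> (f ` A) \<le> (\<Sum>i. diameter_weight k (V i))"
      by (rule hausdorff_content_le)
    also have "\<dots> \<le> (\<Sum>i. diameter_weight k (U i))"
    proof (intro suminf_le)
      fix i
      show "diameter_weight k (V i) \<le> diameter_weight k (U i)"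
      proof (cases "V i = {}")
        case False
        then have "U i \<noteq> {}" by (auto simp: V_def)
        then show ?thesis
          using V[of i] diameter_weight_le[of "V i" "diameter (U i)" k] by (simp add: diameter_weight_def)
      qed simp
    qed auto
    finally show "hausdorff_content k \<delta> (f ` A) \<le> (\<Sum>i. diameter_weight k (U i))" .
  qed
  then show "hausdorff_content k \<delta> (f ` A) \<le> hausdorff_outer_measure k A"
    using hausdorff_content_le_outer[OF \<open>\<delta> > 0\<close>] order_trans by blast
qed

lemma hausdorff_outer_isometry:
  fixes f :: "'a::metric_space \<Rightarrow> 'b::metric_space"
  assumes f: "\<And>x y. x \<in> A \<Longrightarrow> y \<in> A \<Longrightarrow> dist (f x) (f y) = dist x y"
  shows "hausdorff_outer_measure k (f ` A) = hausdorff_outer_measure k A"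
proof (rule antisym)
  have inj: "inj_on f A" by (rule inj_onI) (metis f dist_eq_0_iff)
  have "hausdorff_outer_measure k (the_inv_into A f ` f ` A) \<le> hausdorff_outer_measure k (f ` A)"
    by (rule hausdorff_outer_image_le) (auto simp: the_inv_into_f_f[OF inj] f)
  then show "hausdorff_outer_measure k A \<le> hausdorff_outer_measure k (f ` A)"
    by (simp add: the_inv_into_onto[OF inj])
qed (simp add: hausdorff_outer_image_le f)

lemma distr_hausdorff_reflection:
  fixes \<omega> :: "'a::euclidean_space"
  assumes \<omega>: "norm \<omega> = 1"
  shows "distr (hausdorff_measure k) borel (hyperplane_reflection l \<omega>) = hausdorff_measure k"
proof (rule measure_eqI)
  let ?T = "hyperplane_reflection l \<omega>"
  fix X assume "X \<in> sets (distr (hausdorff_measure k) borel ?T)"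
  then have X: "X \<in> sets borel" by simp
  have T: "?T \<in> hausdorff_measure k \<rightarrow>\<^sub>M borel"
    using borel_measurable_reflection measurable_cong_sets[OF sets_hausdorff_measure refl] by blast
  have vim: "?T -` X = ?T ` X"
  proof (intro set_eqI iffI)
    fix y assume "y \<in> ?T -` X"
    then have "?T (?T y) \<in> ?T ` X" by (intro imageI) simp
    then show "y \<in> ?T ` X" by (simp add: \<omega>)
  qed (auto simp: \<omega>)
  have "?T -` X \<in> sets borel"
    using measurable_sets[OF borel_measurable_reflection X, of l \<omega>] by simp
  then have "emeasure (distr (hausdorff_measure k) borel ?T) X = hausdorff_outer_measure k (?T ` X)"
    using X T by (simp add: emeasure_distr emeasure_hausdorff_measure vim)
  also have "\<dots> = hausdorff_outer_measure k X"
    by (rule hausdorff_outer_isometry) (rule dist_reflection_reflection[OF \<omega>])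
  finally show "emeasure (distr (hausdorff_measure k) borel ?T) X = emeasure (hausdorff_measure k) X"
    using X by (simp add: emeasure_hausdorff_measure)
qed simp

section \<open>The Hausdorff measure of a convex set in its own dimension\<close>

lemma hausdorff_content_finite_cover:
  fixes U :: "'b \<Rightarrow> 'a::metric_space set"
  assumes "finite F" "0 \<le> \<delta>" "A \<subseteq> (\<Union>f\<in>F. U f)"
    and U: "\<And>f. f \<in> F \<Longrightarrow> bounded (U f) \<and> diameter (U f) \<le> \<delta>"
  shows "hausdorff_content k \<delta> A \<le> (\<Sum>f\<in>F. diameter_weight k (U f))"
proof -
  obtain h where h: "bij_betw h {..<card F} F"
    using ex_bij_betw_nat_finite[OF \<open>finite F\<close>] by (auto simp: atLeast0LessThan)
  define V where "V i = (if i < card F then U (h i) else {})" for i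
  have hF: "h i \<in> F" if "i < card F" for i using h that by (auto simp: bij_betw_def)
  have "fine_cover \<delta> A V"
    unfolding fine_cover_def
  proof (intro conjI allI subsetI)
    fix x assume "x \<in> A"
    then obtain f where "f \<in> F" "x \<in> U f" using assms by blast
    moreover then obtain i where "i < card F" "f = h i" using h by (auto simp: bij_betw_def)
    ultimately have "x \<in> V i" by (simp add: V_def)
    then show "x \<in> (\<Union>i. V i)" by blast
  qed (use U hF \<open>0 \<le> \<delta>\<close> in \<open>auto simp: V_def\<close>)
  then have "hausdorff_content k \<delta> A \<le> (\<Sum>i. diameter_weight k (V i))"
    by (rule hausdorff_content_le)
  also have "\<dots> = (\<Sum>i<card F. diameter_weight k (V i))"
    by (rule suminf_finite) (auto simp: V_def)
  also have "\<dots> = (\<Sum>i<card F. diameter_weight k (U (h i)))"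
    by (simp add: V_def)
  also have "\<dots> = (\<Sum>f\<in>F. diameter_weight k (U f))"
    by (rule sum.reindex_bij_betw[OF h])
  finally show ?thesis .
qed

text \<open>
  The closed unit cells \<open>[j, j + 1]\<close> with \<open>j < m\<close> cover \<open>[0, m]\<close>; the right end point \<open>m\<close> goes into
  the last one.
\<close>

lemma ex_unit_cell:
  fixes t :: real
  assumes "0 \<le> t" "t \<le> real m" "m > 0"
  shows "\<exists>j<m. real j \<le> t \<and> t \<le> real j + 1"
proof (cases "t = real m")
  case True
  then show ?thesis using assms by (intro exI[of _ "m - 1"]) auto
next
  case False
  then show ?thesis
    using assms by (intro exI[of _ "nat \<lfloor>t\<rfloor>"]) (auto simp: nat_less_iff floor_less_iff)
qed

text \<open>
  A grid of \<open>m ^ k\<close> cells of side \<open>2 * R / m\<close> in the coordinate subspace spanned by the \<open>k\<close> vectors of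
  \<open>D\<close> covers \<open>A\<close>.  Each cell has diameter at most \<open>k * (2 * R / m)\<close>, so the factor \<open>m ^ k\<close> cancels and
  the total weight is bounded independently of \<open>m\<close>.
\<close>

lemma hausdorff_outer_finite_coordinate:
  fixes A :: "'a::euclidean_space set"
  assumes D: "D \<subseteq> Basis" and A: "bounded A" "A \<subseteq> {x. \<forall>i\<in>Basis. i \<notin> D \<longrightarrow> x \<bullet> i = 0}"
  shows "hausdorff_outer_measure (card D) A < \<infinity>"
proof -
  let ?k = "card D"
  have finD: "finite D" using D finite_Basis finite_subset by blast
  obtain R where R: "R > 0" "\<And>x. x \<in> A \<Longrightarrow> norm x \<le> R"
    using \<open>bounded A\<close> by (auto simp: bounded_pos)
  have "hausdorff_outer_measure ?k A \<le> ennreal (unit_ball_vol (real ?k) * (real ?k * R) ^ ?k)"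
  proof (rule hausdorff_outer_least)
    fix \<delta> :: real assume "\<delta> > 0"
    obtain m :: nat where m: "real ?k * (2 * R) / \<delta> < real m" using reals_Archimedean2 by blast
    then have "m > 0" using R \<open>\<delta> > 0\<close>
      by (metis divide_nonneg_pos gr0I less_le_not_le mult_nonneg_nonneg of_nat_0 of_nat_0_le_iff zero_le_numeral)
    define s where "s = 2 * R / real m"
    have s: "s > 0" "real m * s = 2 * R" using R \<open>m > 0\<close> by (auto simp: s_def)
    have ks: "real ?k * s \<le> \<delta>"
      using m \<open>m > 0\<close> \<open>\<delta> > 0\<close> by (simp add: s_def field_simps)
    define cell where "cell f = {x. (\<forall>i\<in>Basis. i \<notin> D \<longrightarrow> x \<bullet> i = 0) \<and>
        (\<forall>i\<in>D. s * real (f i) - R \<le> x \<bullet> i \<and> x \<bullet> i \<le> s * real (f i) + s - R)}" for f :: "'a \<Rightarrow> nat"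
    have dist_cell: "dist x y \<le> real ?k * s" if "x \<in> cell f" "y \<in> cell f" for x y f
    proof -
      have "dist x y \<le> (\<Sum>i\<in>Basis. \<bar>(x - y) \<bullet> i\<bar>)" by (simp add: dist_norm norm_le_l1)
      also have "\<dots> = (\<Sum>i\<in>D. \<bar>(x - y) \<bullet> i\<bar>)"
        using that by (intro sum.mono_neutral_right D) (auto simp: cell_def inner_diff_left)
      also have "\<dots> \<le> (\<Sum>i\<in>D. s)"
      proof (rule sum_mono)
        fix i assume "i \<in> D"
        with that have "s * real (f i) - R \<le> x \<bullet> i" "x \<bullet> i \<le> s * real (f i) + s - R"
            "s * real (f i) - R \<le> y \<bullet> i" "y \<bullet> i \<le> s * real (f i) + s - R"
          by (auto simp: cell_def)
        then show "\<bar>(x - y) \<bullet> i\<bar> \<le> s" by (simp add: inner_diff_left)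
      qed
      finally show ?thesis by simp
    qed
    have cell: "bounded (cell f) \<and> diameter (cell f) \<le> real ?k * s" for f
    proof
      show "bounded (cell f)" unfolding bounded_two_points using dist_cell by blast
      show "diameter (cell f) \<le> real ?k * s"
        using s dist_cell by (intro diameter_le) (auto simp: dist_norm)
    qed
    let ?F = "D \<rightarrow>\<^sub>E {..<m}"
    have "A \<subseteq> (\<Union>f\<in>?F. cell f)"
    proof
      fix x assume x: "x \<in> A"
      have "\<exists>j<m. s * real j - R \<le> x \<bullet> i \<and> x \<bullet> i \<le> s * real j + s - R" if "i \<in> D" for i
      proof -
        have "\<bar>x \<bullet> i\<bar> \<le> R" using R(2)[OF x] Basis_le_norm[of i x] that D by auto
        then have "0 \<le> (x \<bullet> i + R) / s" "(x \<bullet> i + R) / s \<le> real m"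
          using s by (auto simp: pos_divide_le_eq)
        then obtain j where "j < m" "real j \<le> (x \<bullet> i + R) / s" "(x \<bullet> i + R) / s \<le> real j + 1"
          using ex_unit_cell \<open>m > 0\<close> by blast
        then show ?thesis
          using s by (intro exI[of _ j]) (auto simp: pos_divide_le_eq pos_le_divide_eq algebra_simps)
      qed
      then obtain g where g: "\<And>i. i \<in> D \<Longrightarrow> g i < m \<and> s * real (g i) - R \<le> x \<bullet> i \<and> x \<bullet> i \<le> s * real (g i) + s - R"
        by metis
      have "restrict g D \<in> ?F" using g by auto
      moreover have "x \<in> cell (restrict g D)" using g x A by (auto simp: cell_def)
      ultimately show "x \<in> (\<Union>f\<in>?F. cell f)" by blast
    qed
    then have "hausdorff_content ?k \<delta> A \<le> (\<Sum>f\<in>?F. diameter_weight ?k (cell f))"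
      using finD \<open>\<delta> > 0\<close> cell ks
      by (intro hausdorff_content_finite_cover finite_PiE) (auto intro: order_trans)
    also have "\<dots> \<le> (\<Sum>f\<in>?F. ennreal (unit_ball_vol (real ?k) * (real ?k * s / 2) ^ ?k))"
      using cell by (intro sum_mono diameter_weight_le) auto
    also have "\<dots> = ennreal (real (m ^ ?k) * (unit_ball_vol (real ?k) * (real ?k * s / 2) ^ ?k))"
      using finD s by (subst sum_ennreal) (simp_all add: card_PiE)
    also have "real (m ^ ?k) * (unit_ball_vol (real ?k) * (real ?k * s / 2) ^ ?k)
        = unit_ball_vol (real ?k) * (real ?k * (real m * s) / 2) ^ ?k"
      by (simp add: power_mult_distrib power_divide)
    also have "\<dots> = unit_ball_vol (real ?k) * (real ?k * R) ^ ?k" by (simp add: s)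
    finally show "hausdorff_content ?k \<delta> A \<le> ennreal (unit_ball_vol (real ?k) * (real ?k * R) ^ ?k)" .
  qed
  then show ?thesis by (auto intro: le_less_trans)
qed

text \<open>
  Lower bound by comparison with Lebesgue measure of the whole space.  Each covering set \<open>U i\<close> is
  thickened to a box \<open>W i\<close> of half side \<open>diameter (U i)\<close> in the directions of \<open>D\<close> and \<open>1\<close> in the other
  directions; its volume is a constant \<open>c\<close> times the weight of \<open>U i\<close>.  The boxes cover a full ball
  about \<open>z\<close>, since a point of this ball projects into \<open>A\<close>.  The volume \<open>v\<close> of the ball
  is therefore at most \<open>c\<close> times the total weight of the cover.
\<close>

lemma hausdorff_outer_pos_coordinate:
  fixes A :: "'a::euclidean_space set"
  assumes D: "D \<subseteq> Basis" and "e > 0"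
    and z: "z \<in> V" and A: "ball z e \<inter> V \<subseteq> A"
    and V: "V = {x. \<forall>i\<in>Basis. i \<notin> D \<longrightarrow> x \<bullet> i = 0}"
  shows "0 < hausdorff_outer_measure (card D) A"
proof -
  let ?k = "card D" and ?j = "card (Basis - D)"
  \<comment> \<open>A radius at most \<open>1\<close> keeps the ball within the unit thickening across \<open>V\<close>.\<close>
  define \<epsilon> where "\<epsilon> = min e 1"
  have \<epsilon>: "0 < \<epsilon>" "\<epsilon> \<le> e" "\<epsilon> \<le> 1" using \<open>e > 0\<close> by (auto simp: \<epsilon>_def)
  define v where "v = measure lborel (ball z \<epsilon>)"
  have v: "emeasure lborel (ball z \<epsilon>) = ennreal v"
    unfolding v_def using emeasure_lborel_ball_finite[of z \<epsilon>] by (intro emeasure_eq_ennreal_measure) auto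
  have "v > 0" unfolding v_def using content_ball_pos[OF \<epsilon>(1)] by simp
  define c where "c = 4 ^ ?k * 2 ^ ?j / unit_ball_vol (real ?k)"
  have c: "c > 0" by (simp add: c_def unit_ball_vol_pos)
  have cover: "ennreal v \<le> ennreal c * (\<Sum>i. diameter_weight ?k (U i))" if U: "fine_cover 1 A U" for U
  proof -
    have bU: "bounded (U i)" for i using U by (auto simp: fine_cover_def)
    define u where "u i = (SOME x. x \<in> U i)" for i
    have u: "u i \<in> U i" if "U i \<noteq> {}" for i
      using that unfolding u_def by (simp add: some_in_eq)
    define lo hi where "lo i = (\<Sum>b\<in>Basis. (if b \<in> D then u i \<bullet> b - diameter (U i) else z \<bullet> b - 1) *\<^sub>R b)"
      and "hi i = (\<Sum>b\<in>Basis. (if b \<in> D then u i \<bullet> b + diameter (U i) else z \<bullet> b + 1) *\<^sub>R b)" for i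
    have lo: "lo i \<bullet> b = (if b \<in> D then u i \<bullet> b - diameter (U i) else z \<bullet> b - 1)"
      and hi: "hi i \<bullet> b = (if b \<in> D then u i \<bullet> b + diameter (U i) else z \<bullet> b + 1)" if "b \<in> Basis" for i b
      using that by (simp_all add: lo_def hi_def inner_sum_left_Basis)
    define W where "W i = (if U i = {} then {} else cbox (lo i) (hi i))" for i
    have W: "emeasure lborel (W i) = ennreal c * diameter_weight ?k (U i)" for i
    proof (cases "U i = {}")
      case False
      have "emeasure lborel (cbox (lo i) (hi i)) = ennreal (\<Prod>b\<in>Basis. (hi i - lo i) \<bullet> b)"
        using diameter_ge_0[OF bU] by (intro emeasure_lborel_cbox) (auto simp: lo hi)
      also have "(\<Prod>b\<in>Basis. (hi i - lo i) \<bullet> b) = (\<Prod>b\<in>Basis - D. (hi i - lo i) \<bullet> b) * (\<Prod>b\<in>D. (hi i - lo i) \<bullet> b)"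
        by (rule prod.subset_diff[OF D]) simp
      also have "(\<Prod>b\<in>Basis - D. (hi i - lo i) \<bullet> b) = (\<Prod>b\<in>Basis - D. 2)"
        by (rule prod.cong) (auto simp: lo hi inner_diff_left)
      also have "(\<Prod>b\<in>D. (hi i - lo i) \<bullet> b) = (\<Prod>b\<in>D. 2 * diameter (U i))"
        using D by (intro prod.cong) (auto simp: lo hi inner_diff_left subset_iff)
      also have "(\<Prod>b\<in>Basis - D. 2) * (\<Prod>b\<in>D. 2 * diameter (U i))
          = c * (unit_ball_vol (real ?k) * (diameter (U i) / 2) ^ ?k)"
      proof -
        have pow: "(2 * diameter (U i)) ^ ?k = 4 ^ ?k * (diameter (U i) / 2) ^ ?k"
          by (simp only: power_mult_distrib[symmetric]) simp
        have nz: "unit_ball_vol (real ?k) \<noteq> 0"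
          by (metis less_irrefl of_nat_0_le_iff unit_ball_vol_pos)
        show ?thesis
          unfolding prod_constant pow c_def using nz by simp
      qed
      finally show ?thesis
        using False c by (simp add: W_def diameter_weight_def ennreal_mult')
    qed (simp add: W_def)
    have "ball z \<epsilon> \<subseteq> (\<Union>i. W i)"
    proof
      fix y assume y: "y \<in> ball z \<epsilon>"
      \<comment> \<open>The orthogonal projection of \<open>y\<close> to \<open>V\<close>.\<close>
      define p where "p = (\<Sum>b\<in>Basis. (if b \<in> D then y \<bullet> b else 0) *\<^sub>R b)"
      have p: "p \<bullet> b = (if b \<in> D then y \<bullet> b else 0)" if "b \<in> Basis" for b
        using that by (simp add: p_def inner_sum_left_Basis)
      have "norm (z - p) \<le> norm (z - y)"
        using z by (intro norm_le_componentwise) (auto simp: V inner_diff_left p)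
      then have "p \<in> ball z e" using y \<epsilon> by (auto simp: dist_norm)
      moreover have "p \<in> V" by (auto simp: V p)
      ultimately obtain i where i: "p \<in> U i"
        using A U unfolding fine_cover_def by blast
      have "dist p (u i) \<le> diameter (U i)"
        using i u by (intro diameter_bounded_bound[OF bU]) auto
      have "y \<in> cbox (lo i) (hi i)"
        unfolding mem_box
      proof
        fix b :: 'a assume b: "b \<in> Basis"
        show "lo i \<bullet> b \<le> y \<bullet> b \<and> y \<bullet> b \<le> hi i \<bullet> b"
        proof (cases "b \<in> D")
          case True
          have "\<bar>(p - u i) \<bullet> b\<bar> \<le> diameter (U i)"
            using Basis_le_norm[OF b, of "p - u i"] \<open>dist p (u i) \<le> _\<close> by (simp add: dist_norm)
          with True b show ?thesis by (auto simp: lo hi inner_diff_left p)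
        next
          case False
          have "\<bar>(z - y) \<bullet> b\<bar> \<le> 1"
            using Basis_le_norm[OF b, of "z - y"] y \<epsilon> by (simp add: dist_norm)
          with False b show ?thesis by (auto simp: lo hi inner_diff_left)
        qed
      qed
      then show "y \<in> (\<Union>i. W i)" using i by (auto simp: W_def)
    qed
    then have "emeasure lborel (ball z \<epsilon>) \<le> emeasure lborel (\<Union>i. W i)"
      by (intro emeasure_mono) (auto simp: W_def)
    also have "\<dots> \<le> (\<Sum>i. emeasure lborel (W i))"
      by (intro emeasure_subadditive_countably) (auto simp: W_def)
    finally show ?thesis by (simp add: v W)
  qed
  have "ennreal (v / (2 * c)) \<le> hausdorff_content ?k 1 A"
  proof (rule ccontr)
    assume "\<not> ?thesis"
    then obtain U where U: "fine_cover 1 A U" "(\<Sum>i. diameter_weight ?k (U i)) < ennreal (v / (2 * c))"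
      by (auto simp: not_le elim: hausdorff_content_close)
    then have "ennreal v \<le> ennreal c * ennreal (v / (2 * c))"
      using cover[OF U(1)] by (meson less_imp_le mult_left_mono order_trans zero_le)
    also have "\<dots> = ennreal (v / 2)"
      using c \<open>v > 0\<close> by (simp flip: ennreal_mult)
    finally show False using \<open>v > 0\<close> by simp
  qed
  also have "\<dots> \<le> hausdorff_outer_measure ?k A"
    by (rule hausdorff_content_le_outer) simp
  finally show ?thesis
    using c \<open>v > 0\<close> by (auto intro: less_le_trans[rotated])
qed

text \<open>
  A translation and a linear isometry move \<open>A\<close> into a coordinate subspace without changing its
  Hausdorff measure.  The image spans this subspace, so it contains a ball relative to it, and both
  coordinate estimates apply.
\<close>

proposition hausdorff_outer_convex:
  fixes A :: "'a::euclidean_space set"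
  assumes "convex A" "bounded A" and dim: "aff_dim A = int k"
  shows "0 < hausdorff_outer_measure k A" "hausdorff_outer_measure k A < \<infinity>"
proof -
  have "A \<noteq> {}" using dim by auto
  then obtain a where a: "a \<in> A" by blast
  define A0 where "A0 = (\<lambda>x. x - a) ` A"
  have A0: "convex A0" "bounded A0" "0 \<in> A0"
    using assms a by (auto simp: A0_def convex_translation_subtract bounded_translation_minus)
  define S where "S = span A0"
  have "aff_dim A0 = int k"
    using dim by (simp add: A0_def aff_dim_translation_eq_subtract)
  then have dimS: "dim S = k"
    using aff_dim_zero[of A0] A0(3) hull_inc[of 0 A0] by (simp add: S_def)
  then have "k \<le> card (Basis :: 'a set)"
    using dim_subset_UNIV[of S] by simp
  then obtain D :: "'a set" where D: "D \<subseteq> Basis" "card D = k"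
    by (rule obtain_subset_with_card_n)
  define V where "V = {x::'a. \<forall>i\<in>Basis. i \<notin> D \<longrightarrow> x \<bullet> i = 0}"
  have V: "V = span D" using span_substd_basis[OF D(1)] by (simp add: V_def)
  have "dim V = k" using dim_substandard[OF D(1)] D by (simp add: V_def)
  then have iso: "subspace S" "subspace V" "dim S = dim V"
    using dimS by (auto simp: S_def V)
  obtain f where f: "linear f" "f ` S = V" "\<And>x. x \<in> S \<Longrightarrow> norm (f x) = norm x"
    using isometries_subspaces[OF iso] by metis
  define B where "B = f ` A0"
  have "dist (f x) (f y) = dist x y" if "x \<in> A0" "y \<in> A0" for x y
    using f(3)[of "x - y"] that by (simp add: dist_norm linear_diff[OF f(1)] S_def span_base span_diff)
  then have H: "hausdorff_outer_measure k B = hausdorff_outer_measure k A0"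
    unfolding B_def by (rule hausdorff_outer_isometry)
  have H0: "hausdorff_outer_measure k A0 = hausdorff_outer_measure k A"
    unfolding A0_def by (rule hausdorff_outer_isometry) (simp add: dist_norm)
  have A0S: "A0 \<subseteq> S" by (simp add: S_def span_superset)
  then have BV: "B \<subseteq> V" using f(2) by (auto simp: B_def)
  have "bounded B"
    unfolding B_def using A0(2) f(1) by (simp add: bounded_linear_image linear_linear)
  then show "hausdorff_outer_measure k A < \<infinity>"
    using hausdorff_outer_finite_coordinate[of D B] BV D H H0 by (simp add: V_def)
  have B: "convex B" "0 \<in> B"
    using A0 f(1) linear_0[OF f(1)] by (force simp: B_def convex_linear_image)+
  have "affine hull B = span B"
    using B(2) by (simp add: affine_hull_span_0 hull_inc)
  also have "\<dots> = V"
    using f(1,2) by (simp add: B_def S_def linear_span_image)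
  finally have aff: "affine hull B = V" .
  obtain z where z: "z \<in> rel_interior B"
    using rel_interior_eq_empty[OF B(1)] B(2) by blast
  then obtain e where "z \<in> B" "e > 0" "ball z e \<inter> V \<subseteq> B"
    by (auto simp: mem_rel_interior_ball aff)
  then have "0 < hausdorff_outer_measure (card D) B"
    using BV by (intro hausdorff_outer_pos_coordinate[OF D(1), of e z V]) (auto simp: V_def)
  then show "0 < hausdorff_outer_measure k A"
    by (simp add: D H H0)
qed

section \<open>Incenters\<close>

text \<open>
  An open ball about a point of \<open>K\<close> that is disjoint from the frontier stays in \<open>K\<close>, because it is
  connected.
\<close>

lemma cball_subset_iff_infdist_frontier:
  fixes K :: "'a::euclidean_space set"
  assumes "compact K" "x \<in> K" "0 \<le> r"
  shows "cball x r \<subseteq> K \<longleftrightarrow> r \<le> infdist x (frontier K)"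
proof
  assume sub: "cball x r \<subseteq> K"
  have "frontier K \<noteq> {}"
    using assms frontier_not_empty[of K] compact_imp_bounded[OF \<open>compact K\<close>] not_bounded_UNIV by blast
  moreover have "r \<le> dist x y" if "y \<in> frontier K" for y
  proof (rule ccontr)
    assume "\<not> ?thesis"
    then have "y \<in> ball x r" by simp
    moreover have "ball x r \<subseteq> interior K"
      using sub ball_subset_cball by (intro interior_maximal) (auto simp: subset_iff)
    ultimately show False using that by (auto simp: frontier_def)
  qed
  ultimately show "r \<le> infdist x (frontier K)"
    by (auto simp: infdist_notempty intro: cINF_greatest)
next
  assume r: "r \<le> infdist x (frontier K)"
  show "cball x r \<subseteq> K"
  proof (cases "r = 0")
    case False
    with \<open>0 \<le> r\<close> have "r > 0" by simp
    have "ball x r \<inter> frontier K = {}"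
      using r infdist_le[of _ "frontier K" x] by fastforce
    moreover have "x \<in> ball x r \<inter> K"
      using \<open>r > 0\<close> \<open>x \<in> K\<close> by simp
    ultimately have "ball x r \<subseteq> K"
      using connected_Int_frontier[OF connected_ball, of x r K] by blast
    then show ?thesis
      using closure_minimal[OF _ compact_imp_closed[OF \<open>compact K\<close>], of "ball x r"]
      by (simp only: closure_ball[OF \<open>r > 0\<close>])
  qed (use assms in auto)
qed

text \<open>
  The pairs \<open>(y, s)\<close> with \<open>cball y s \<subseteq> K\<close> form a compact set, on which the radius attains its maximum.
\<close>

lemma ex_largest_inscribed_ball:
  fixes K :: "'a::euclidean_space set"
  assumes "compact K" "K \<noteq> {}"
  shows "\<exists>x r. 0 \<le> r \<and> cball x r \<subseteq> K \<and> (\<forall>y s. 0 \<le> s \<longrightarrow> cball y s \<subseteq> K \<longrightarrow> s \<le> r)"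
proof -
  obtain R where R: "\<And>x. x \<in> K \<Longrightarrow> norm x \<le> R"
    using compact_imp_bounded[OF \<open>compact K\<close>] by (auto simp: bounded_iff)
  have ball: "cball y s \<subseteq> K \<longleftrightarrow> (\<forall>u\<in>cball 0 1. y + s *\<^sub>R u \<in> K)" if "0 \<le> s" for y s
  proof (cases "s = 0")
    case False
    show ?thesis
    proof
      assume *: "\<forall>u\<in>cball 0 1. y + s *\<^sub>R u \<in> K"
      show "cball y s \<subseteq> K"
      proof
        fix w assume "w \<in> cball y s"
        then have "(1 / s) *\<^sub>R (w - y) \<in> cball 0 1"
          using that False by (simp add: dist_norm norm_minus_commute)
        with * have "y + s *\<^sub>R ((1 / s) *\<^sub>R (w - y)) \<in> K" by blast
        then show "w \<in> K" using False by simp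
      qed
    next
      assume "cball y s \<subseteq> K"
      then show "\<forall>u\<in>cball 0 1. y + s *\<^sub>R u \<in> K"
        using that by (auto simp: subset_iff dist_norm mult_left_le)
    qed
  next
    case True
    have "(0::'a) \<in> cball 0 1" by simp
    then show ?thesis
      unfolding True scaleR_zero_left add_0_right cball_trivial by blast
  qed
  have rad: "s \<le> 2 * R" if "0 \<le> s" "cball y s \<subseteq> K" for y s
  proof -
    obtain b :: 'a where "b \<in> Basis" by fastforce
    then have "y \<in> K" "y + s *\<^sub>R b \<in> K" using that by (auto simp: dist_norm subset_iff)
    then have "norm (s *\<^sub>R b) \<le> R + R"
      using R[of y] R[of "y + s *\<^sub>R b"] norm_triangle_ineq4[of "y + s *\<^sub>R b" y] by simp
    then show ?thesis using \<open>b \<in> Basis\<close> \<open>0 \<le> s\<close> by simp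
  qed
  define P where "P = (K \<times> {0..2 * R}) \<inter> (\<Inter>u\<in>cball 0 1. (\<lambda>p. fst p + snd p *\<^sub>R u) -` K)"
  have P: "(y, s) \<in> P \<longleftrightarrow> 0 \<le> s \<and> cball y s \<subseteq> K" for y s
    using ball[of s y] rad[of s y] by (auto simp: P_def)
  have "compact P"
    unfolding P_def
    by (intro compact_Int_closed compact_Times assms compact_Icc closed_INT ballI closed_vimage
        compact_imp_closed continuous_intros)
  moreover obtain z where "z \<in> K" using assms by blast
  then have "P \<noteq> {}" using P[of z 0] by auto
  ultimately obtain p where p: "p \<in> P" "\<And>q. q \<in> P \<Longrightarrow> snd q \<le> snd p"
    using continuous_attains_sup[of P snd] continuous_on_snd[OF continuous_on_id, of P] by blast
  show ?thesis
  proof (intro exI[of _ "fst p"] exI[of _ "snd p"] conjI allI impI)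
    have "(fst p, snd p) \<in> P" using p(1) by simp
    then show "0 \<le> snd p" "cball (fst p) (snd p) \<subseteq> K" unfolding P by blast+
    fix y s assume "0 \<le> s" "cball y s \<subseteq> K"
    then have "(y, s) \<in> P" unfolding P by simp
    from p(2)[OF this] show "s \<le> snd p" by simp
  qed
qed

text \<open>
  The definition of \<open>incenters\<close> by the distance to the frontier amounts to being the center of an
  inscribed ball of maximal radius.  This form makes convexity, compactness and the behaviour under
  folding accessible.
\<close>

lemma incenters_eq:
  fixes K :: "'a::euclidean_space set"
  assumes "compact K" "K \<noteq> {}"
  shows "0 \<le> inradius K" "incenters K = {x. cball x (inradius K) \<subseteq> K}" "incenters K \<noteq> {}"
proof -
  obtain x0 r where r: "0 \<le> r" "cball x0 r \<subseteq> K"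
    and *: "\<forall>y s. 0 \<le> s \<longrightarrow> cball y s \<subseteq> K \<longrightarrow> s \<le> r"
    using ex_largest_inscribed_ball[OF assms] by (elim exE conjE)
  from * have max: "\<And>y s. 0 \<le> s \<Longrightarrow> cball y s \<subseteq> K \<Longrightarrow> s \<le> r"
    by simp
  have inr: "inradius K = r"
    unfolding inradius_def by (rule Greatest_equality) (use r max in blast)+
  show "0 \<le> inradius K" by (simp add: inr r)
  show eq: "incenters K = {x. cball x (inradius K) \<subseteq> K}"
  proof (intro set_eqI iffI)
    fix x assume "x \<in> incenters K"
    then show "x \<in> {x. cball x (inradius K) \<subseteq> K}"
      using cball_subset_iff_infdist_frontier[OF \<open>compact K\<close>, of x r] r by (simp add: incenters_def inr)
  next
    fix x assume "x \<in> {x. cball x (inradius K) \<subseteq> K}"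
    then have sub: "cball x r \<subseteq> K" by (simp add: inr)
    then have "x \<in> K" using r by auto
    moreover have "r \<le> infdist x (frontier K)"
      using cball_subset_iff_infdist_frontier[OF \<open>compact K\<close> \<open>x \<in> K\<close> r(1)] sub by simp
    moreover have "infdist x (frontier K) \<le> r"
  proof (rule max[OF infdist_nonneg])
      show "cball x (infdist x (frontier K)) \<subseteq> K"
        using cball_subset_iff_infdist_frontier[OF \<open>compact K\<close> \<open>x \<in> K\<close> infdist_nonneg] by blast
    qed
    ultimately show "x \<in> incenters K" by (simp add: incenters_def inr)
  qed
  show "incenters K \<noteq> {}" using r(2) unfolding eq inr by blast
qed

text \<open>
  The set of incenters is an intersection of translates of \<open>K\<close> and so inherits closedness and
  convexity from it.
\<close>

lemma mem_incenters_iff: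
  fixes K :: "'a::euclidean_space set"
  assumes "compact K" "K \<noteq> {}"
  shows "x \<in> incenters K \<longleftrightarrow> (\<forall>u\<in>cball 0 (inradius K). x + u \<in> K)"
proof -
  have "cball x (inradius K) \<subseteq> K \<longleftrightarrow> (\<forall>u\<in>cball 0 (inradius K). x + u \<in> K)"
  proof (intro iffI ballI subsetI)
    fix w assume *: "\<forall>u\<in>cball 0 (inradius K). x + u \<in> K" and "w \<in> cball x (inradius K)"
    then have "w - x \<in> cball 0 (inradius K)" by (simp add: dist_norm norm_minus_commute)
    with * have "x + (w - x) \<in> K" by blast
    then show "w \<in> K" by simp
  next
    fix u :: 'a assume *: "cball x (inradius K) \<subseteq> K" and "u \<in> cball 0 (inradius K)"
    then have "x + u \<in> cball x (inradius K)" by (simp add: dist_norm)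
    with * show "x + u \<in> K" by blast
  qed
  then show ?thesis
    unfolding incenters_eq(2)[OF assms] mem_Collect_eq .
qed

lemma incenters_subset: "incenters K \<subseteq> K"
  by (auto simp: incenters_def)

lemma compact_incenters:
  fixes K :: "'a::euclidean_space set"
  assumes "compact K" "K \<noteq> {}"
  shows "compact (incenters K)"
proof -
  have "incenters K = (\<Inter>u\<in>cball 0 (inradius K). (\<lambda>x. x + u) -` K)"
    using mem_incenters_iff[OF assms] by blast
  then have "closed (incenters K)"
    by (simp only:) (intro closed_INT ballI closed_vimage compact_imp_closed assms continuous_intros)
  moreover have "bounded (incenters K)"
    using compact_imp_bounded[OF \<open>compact K\<close>] incenters_subset by (rule bounded_subset)
  ultimately show ?thesis by (simp add: compact_eq_bounded_closed)
qed

lemma convex_incenters: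
  fixes K :: "'a::euclidean_space set"
  assumes "compact K" "K \<noteq> {}" "convex K"
  shows "convex (incenters K)"
proof (rule convexI)
  fix x y and a b :: real
  assume xy: "x \<in> incenters K" "y \<in> incenters K" and ab: "0 \<le> a" "0 \<le> b" "a + b = 1"
  show "a *\<^sub>R x + b *\<^sub>R y \<in> incenters K"
    unfolding mem_incenters_iff[OF assms(1,2)]
  proof
    fix u :: 'a assume "u \<in> cball 0 (inradius K)"
    then have "a *\<^sub>R (x + u) + b *\<^sub>R (y + u) \<in> K"
      using xy ab by (intro convexD[OF \<open>convex K\<close>]) (simp_all add: mem_incenters_iff[OF assms(1,2)])
    moreover have "a *\<^sub>R (x + u) + b *\<^sub>R (y + u) = a *\<^sub>R x + b *\<^sub>R y + (a + b) *\<^sub>R u"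
      by (simp only: algebra_simps)
    ultimately show "a *\<^sub>R x + b *\<^sub>R y + u \<in> K" using ab by simp
  qed
qed

text \<open>
  Let \<open>x\<close> be an incenter above the hyperplane and \<open>y\<close> a point of the reflected inscribed ball, so that
  \<open>?T y\<close> is in the original inscribed ball and hence in \<open>K\<close>.  If \<open>?T y\<close> is above the hyperplane, its
  reflection \<open>y\<close> is in \<open>K\<close> by assumption.  Otherwise \<open>y\<close> is on the same side as \<open>x\<close>, thus no farther
  from \<open>x\<close> than from \<open>?T x\<close>, and lies in the original inscribed ball itself.
\<close>

lemma folds_into_incenters:
  fixes K :: "'a::euclidean_space set"
  assumes "compact K" "K \<noteq> {}" and \<omega>: "norm \<omega> = 1" and fold: "folds_into K l \<omega>"
  shows "folds_into (incenters K) l \<omega>"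
  unfolding folds_into_def incenters_eq(2)[OF assms(1,2)]
proof (intro ballI impI CollectI subsetI; elim CollectE)
  let ?T = "hyperplane_reflection l \<omega>"
  fix x y assume x: "cball x (inradius K) \<subseteq> K" "l \<le> x \<bullet> \<omega>" and y: "y \<in> cball (?T x) (inradius K)"
  have Ty: "?T y \<in> K"
    using x(1) y dist_reflection_reflection[OF \<omega>, of l "?T x" y] by (auto simp: \<omega>)
  show "y \<in> K"
  proof (cases "l \<le> ?T y \<bullet> \<omega>")
    case True
    then show ?thesis using fold Ty reflection_reflection[OF \<omega>, of l y] by (metis folds_into_def)
  next
    case False
    then have "dist y x \<le> dist y (?T x)"
      using x(2) by (intro dist_reflection_ge[OF \<omega>] mult_nonpos_nonpos) (auto simp: reflection_inner \<omega>)
    then show ?thesis using x(1) y by (auto simp: dist_commute)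
  qed
qed

lemma incenters_centroid_mem_heart:
  fixes K :: "'a::euclidean_space set"
  assumes "convex_body K"
  shows "incenters_centroid K \<in> heart K"
proof -
  have K: "compact K" "convex K" "K \<noteq> {}" using assms by (auto simp: convex_body_def)
  let ?I = "incenters K"
  have I: "compact ?I" "convex ?I" "?I \<noteq> {}"
    using K by (auto simp: compact_incenters convex_incenters incenters_eq(3))
  have "incenters_centroid K \<in> ?I \<and>
      (\<forall>\<omega> l. norm \<omega> = 1 \<longrightarrow> folds_into ?I l \<omega> \<longrightarrow> incenters_centroid K \<bullet> \<omega> \<le> l)"
  proof (cases "aff_dim ?I \<ge> 1")
    case True
    define k where "k = nat (aff_dim ?I)"
    have "aff_dim ?I = int k" using True by (simp add: k_def)
    then have pos: "0 < emeasure (hausdorff_measure k) ?I" and fin: "emeasure (hausdorff_measure k) ?I < \<infinity>"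
      using hausdorff_outer_convex[of ?I k] I
      by (auto simp: emeasure_hausdorff_measure borel_compact compact_imp_bounded)
    have eq: "incenters_centroid K = mass_center (hausdorff_measure k) ?I"
      using True by (simp add: incenters_centroid_def k_def)
    show ?thesis
      unfolding eq using I pos fin
      by (intro conjI allI impI mass_center_mem mass_center_inner_le distr_hausdorff_reflection) auto
  next
    case False
    then have "aff_dim ?I = 0" using I(3) aff_dim_geq[of ?I] aff_dim_empty[of ?I] by linarith
    then obtain x where x: "?I = {x}" by (auto simp: aff_dim_eq_0)
    then have eq: "incenters_centroid K = x" by (simp add: incenters_centroid_def)
    \<comment> \<open>A single incenter above the hyperplane would be its own mirror image.\<close>
    have "x \<bullet> \<omega> \<le> l" if "norm \<omega> = 1" "folds_into ?I l \<omega>" for \<omega> l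
    proof (rule ccontr)
      assume "\<not> ?thesis"
      then have "hyperplane_reflection l \<omega> x = x" using that by (auto simp: folds_into_def x)
      then have "x \<bullet> \<omega> = 2 * l - x \<bullet> \<omega>" using reflection_inner[OF that(1), of l x] by simp
      with \<open>\<not> ?thesis\<close> show False by simp
    qed
    then show ?thesis by (simp add: eq x)
  qed
  then show ?thesis
    using K incenters_subset[of K] by (intro mem_heartI) (auto intro: folds_into_incenters)
qed

section \<open>The circumcenter\<close>

definition minimal_enclosing_ball :: "'a::euclidean_space set \<Rightarrow> 'a \<Rightarrow> real \<Rightarrow> bool" where
  "minimal_enclosing_ball K c r \<longleftrightarrow> K \<subseteq> cball c r \<and> (\<forall>c' r'. K \<subseteq> cball c' r' \<longrightarrow> r \<le> r')"

text \<open>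
  Projecting the center to \<open>K\<close> keeps a ball enclosing, since the projection is a contraction that fixes
  \<open>K\<close>.  So only centers in \<open>K\<close> and radii up to the diameter of \<open>K\<close> compete, and these form a compact
  set of pairs.
\<close>

lemma ex_minimal_enclosing_ball:
  fixes K :: "'a::euclidean_space set"
  assumes "compact K" "convex K" "K \<noteq> {}"
  obtains c r where "minimal_enclosing_ball K c r" "c \<in> K"
proof -
  have retract: "K \<subseteq> cball (closest_point K c) r" if "K \<subseteq> cball c r" for c r
  proof
    fix y assume y: "y \<in> K"
    have "dist (closest_point K c) (closest_point K y) \<le> dist c y"
      using assms by (intro closest_point_lipschitz) (auto simp: compact_imp_closed)
    then show "y \<in> cball (closest_point K c) r"
      using that y by (auto simp: closest_point_self)
  qed
  define P where "P = (K \<times> {0..diameter K}) \<inter> (\<Inter>y\<in>K. {p. dist (fst p) y \<le> snd p})"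
  have "compact P"
    unfolding P_def
    by (intro compact_Int_closed compact_Times assms compact_Icc closed_INT ballI closed_Collect_le
        continuous_intros)
  moreover obtain z where z: "z \<in> K" using assms by blast
  have "(z, diameter K) \<in> P"
    using z diameter_bounded_bound[OF compact_imp_bounded[OF \<open>compact K\<close>]]
      diameter_ge_0[OF compact_imp_bounded[OF \<open>compact K\<close>]] by (auto simp: P_def)
  then have "P \<noteq> {}" by blast
  ultimately obtain p where p: "p \<in> P" "\<And>q. q \<in> P \<Longrightarrow> snd p \<le> snd q"
    using continuous_attains_inf[of P snd] continuous_on_snd[OF continuous_on_id, of P] by blast
  have "snd p \<le> r" if "K \<subseteq> cball c r" for c r
  proof (cases "r \<le> diameter K")
    case True
    have "dist c z \<le> r" using that z by auto
    then have "0 \<le> r" using zero_le_dist order_trans by blast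
    then have "(closest_point K c, r) \<in> P"
      using True retract[OF that] assms
      by (auto simp: P_def compact_imp_closed closest_point_in_set subset_iff)
    then show ?thesis using p(2) by fastforce
  next
    case False
    then show ?thesis using p(1) by (auto simp: P_def)
  qed
  then show ?thesis
    using p(1) by (intro that[of "fst p" "snd p"]) (auto simp: minimal_enclosing_ball_def P_def)
qed

text \<open>
  By the parallelogram identity, two enclosing balls of radius \<open>r\<close> with centers at distance \<open>\<Delta>\<close> would
  allow an enclosing ball of radius \<open>sqrt (r\<^sup>2 - \<Delta>\<^sup>2 / 4)\<close> about the midpoint.
\<close>

lemma minimal_enclosing_ball_unique:
  fixes K :: "'a::euclidean_space set"
  assumes c: "minimal_enclosing_ball K c r" and d: "minimal_enclosing_ball K d s" and "K \<noteq> {}"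
  shows "d = c"
proof -
  have "s = r" using c d unfolding minimal_enclosing_ball_def by (blast intro: antisym)
  define m where "m = (1/2) *\<^sub>R (c + d)"
  have par: "(dist m y)\<^sup>2 \<le> r\<^sup>2 - (dist c d)\<^sup>2 / 4" if "y \<in> K" for y
  proof -
    have le: "(dist c y)\<^sup>2 \<le> r\<^sup>2" "(dist d y)\<^sup>2 \<le> r\<^sup>2"
      using that c d \<open>s = r\<close> by (auto simp: minimal_enclosing_ball_def subset_iff intro!: power_mono)
    have "(dist m y)\<^sup>2 = ((dist c y)\<^sup>2 + (dist d y)\<^sup>2) / 2 - (dist c d)\<^sup>2 / 4"
      unfolding dist_norm m_def power2_norm_eq_inner
      by (simp add: inner_diff_left inner_diff_right inner_add_left inner_add_right inner_commute algebra_simps)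
         (simp add: field_simps)
    also have "\<dots> \<le> (r\<^sup>2 + r\<^sup>2) / 2 - (dist c d)\<^sup>2 / 4"
      by (intro diff_right_mono divide_right_mono add_mono le) simp
    finally show ?thesis by simp
  qed
  obtain y where y: "y \<in> K" using \<open>K \<noteq> {}\<close> by blast
  have "K \<subseteq> cball m (sqrt (r\<^sup>2 - (dist c d)\<^sup>2 / 4))"
  proof
    fix x assume "x \<in> K"
    then show "x \<in> cball m (sqrt (r\<^sup>2 - (dist c d)\<^sup>2 / 4))"
      using real_le_rsqrt[OF par, of x] by simp
  qed
  then have "r \<le> sqrt (r\<^sup>2 - (dist c d)\<^sup>2 / 4)"
    using c by (auto simp: minimal_enclosing_ball_def)
  moreover have "0 \<le> r"
  proof -
    have "dist c y \<le> r" using y c by (auto simp: minimal_enclosing_ball_def)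
    then show ?thesis using zero_le_dist order_trans by blast
  qed
  ultimately have "r\<^sup>2 \<le> r\<^sup>2 - (dist c d)\<^sup>2 / 4"
    using par[OF y] by (metis power2_eq_square real_sqrt_pow2 order_trans power_mono zero_le_power2)
  then show ?thesis by simp
qed

text \<open>
  If \<open>c\<close> is strictly above the hyperplane, a point of \<open>K\<close> above it is as close to \<open>?T c\<close> as its mirror
  image, which is in \<open>K\<close>, is to \<open>c\<close>; a point of \<open>K\<close> below it is closer to \<open>?T c\<close> than to \<open>c\<close>.
  So \<open>?T c\<close> is the center of another smallest enclosing ball.
\<close>

lemma circumcenter_mem_heart:
  fixes K :: "'a::euclidean_space set"
  assumes "convex_body K"
  shows "circumcenter K \<in> heart K"
proof -
  have K: "compact K" "convex K" "K \<noteq> {}" using assms by (auto simp: convex_body_def)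
  then obtain c r where c: "minimal_enclosing_ball K c r" "c \<in> K"
    using ex_minimal_enclosing_ball by blast
  have eq: "circumcenter K = c"
    unfolding circumcenter_def minimal_enclosing_ball_def[symmetric]
    by (rule the_equality) (use c minimal_enclosing_ball_unique K in blast)+
  have "c \<bullet> \<omega> \<le> l" if \<omega>: "norm \<omega> = 1" and fold: "folds_into K l \<omega>" for \<omega> l
  proof (rule ccontr)
    assume less: "\<not> c \<bullet> \<omega> \<le> l"
    let ?T = "hyperplane_reflection l \<omega>"
    have "K \<subseteq> cball (?T c) r"
    proof
      fix x assume x: "x \<in> K"
      have "dist x (?T c) \<le> r"
      proof (cases "l \<le> x \<bullet> \<omega>")
        case True
        then have "?T x \<in> K" using fold x by (auto simp: folds_into_def)
        then show ?thesis
          using c(1) dist_reflection_reflection[OF \<omega>, of l "?T x" c]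
          by (auto simp: minimal_enclosing_ball_def dist_commute \<omega>)
      next
        case False
        have "dist x (?T c) \<le> dist x (?T (?T c))"
          using less False by (intro dist_reflection_ge[OF \<omega>] mult_nonneg_nonneg) (auto simp: reflection_inner \<omega>)
        then show ?thesis
          using c(1) x by (auto simp: minimal_enclosing_ball_def dist_commute \<omega>)
      qed
      then show "x \<in> cball (?T c) r" by (simp add: dist_commute)
    qed
    then have "minimal_enclosing_ball K (?T c) r"
      using c(1) by (auto simp: minimal_enclosing_ball_def)
    then have "?T c = c" using minimal_enclosing_ball_unique c(1) K(3) by blast
    then show False using less reflection_inner[OF \<omega>, of l c] by simp
  qed
  then show ?thesis
    unfolding eq using K c(2) by (intro mem_heartI) auto
qed

section \<open>The diameter of the heart\<close>

theorem theorem3p5: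
  fixes K :: "'a::euclidean_space set"
  assumes "convex_body K"
  shows "diameter (heart K) \<ge>
    Max {norm (centroid K - circumcenter K),
         norm (circumcenter K - incenters_centroid K),
         norm (incenters_centroid K - centroid K)}"
proof -
  have "heart K \<subseteq> K" by (auto simp: heart_def)
  then have "bounded (heart K)"
    using assms compact_imp_bounded bounded_subset by (auto simp: convex_body_def)
  then have "norm (p - q) \<le> diameter (heart K)" if "p \<in> heart K" "q \<in> heart K" for p q
    using that diameter_bounded_bound[of "heart K" p q] by (simp add: dist_norm)
  then show ?thesis
    using centroid_mem_heart[OF assms] circumcenter_mem_heart[OF assms]
      incenters_centroid_mem_heart[OF assms] by simp
qed

end
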